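(* For every integer $k\ge 148$, there is no $s$-extremal singly even self-dual $[24k+16,12k+8,4k+4]$ code. Equivalently, for every integer $k\ge 148$, there is no extremal doubly even self-dual $[24k+16,12k+8,4k+4]$ code with covering radius $4k+4$, meeting the Delsarte bound.
   Context: All codes are binary: an $[n,m]$ code is an $m$-dimensional subspace $C$ of $\mathbb{F}_2^n$, and it is an $[n,m,d]$ code if its minimum non-zero weight $d(C)$ is $d$. The dual is $C^\perp=\{x\in\mathbb{F}_2^n \mid x\cdot y=0 \text{ for all } y\in C\}$ for the standard inner product, and $C$ is self-dual if $C=C^\perp$. A self-dual code is doubly even if all its weights are $\equiv 0\pmod 4$, and singly even if some codeword has weight $\equiv 2\pmod 4$. A self-dual code of length $n$ satisfies $d(C)\le 4\lfloor n/24\rfloor+4$ unless $n\equiv 22\pmod{24}$, in which case $d(C)\le 4\lfloor n/24\rfloor+6$; it is extremal if it meets this bound. For a singly even self-dual code $C$, let $C_0$ be the subcode (of codimension 1) of codewords of weight $\equiv 0\pmod 4$; the shadow of $C$ is $S=C_0^\perp\setminus C$, and $d(S)$ is the minimum non-zero weight of the vectors in $S$. A singly even self-dual code $C$ of length $n$ satisfies $d(S)\le \frac n2+4-2d(C)$ unless $n\equiv 22\pmod{24}$ and $d(C)=4\lfloor n/24\rfloor+6$; outside this exceptional case, $C$ is called $s$-extremal if $d(S)=\frac n2+4-2d(C)$. The covering radius $R(C)$ is the smallest integer $R$ such that the Hamming spheres of radius $R$ around the codewords of $C$ cover $\mathbb{F}_2^n$. The Delsarte bound states $R(C)\le|\{i\mid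 A_i^\perp\neq 0,\ 0<i\le n\}|$, where $A_i^\perp$ is the number of vectors of weight $i$ in $C^\perp$. *)

theory Defs
  imports "HOL-Analysis.Analysis" "HOL-Library.Z2"
begin

text \<open>
  The ambient space \<open>F\<^sub>2\<^sup>n\<close> is the type \<open>bit ^ 'n\<close> with \<open>CARD('n) = n\<close>.
\<close>

definition weight :: "bit ^ 'n \<Rightarrow> nat" where
  "weight x = card {i. x $ i \<noteq> 0}"

definition hamming_dist :: "bit ^ 'n \<Rightarrow> bit ^ 'n \<Rightarrow> nat" where
  "hamming_dist x y = card {i. x $ i \<noteq> y $ i}"

text \<open>Meaningful only if the set contains a non-zero vector.\<close>

definition min_weight :: "(bit ^ 'n) set \<Rightarrow> nat" where
  "min_weight S = Min (weight ` (S - {0}))"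

definition is_code :: "nat \<Rightarrow> nat \<Rightarrow> (bit ^ 'n) set \<Rightarrow> bool" where
  "is_code n m C \<longleftrightarrow> CARD('n) = n \<and> vec.subspace C \<and> vec.dim C = m"

definition is_code_dist :: "nat \<Rightarrow> nat \<Rightarrow> nat \<Rightarrow> (bit ^ 'n) set \<Rightarrow> bool" where
  "is_code_dist n m d C \<longleftrightarrow> is_code n m C \<and> C \<noteq> {0} \<and> min_weight C = d"

definition dual_code :: "(bit ^ 'n) set \<Rightarrow> (bit ^ 'n) set" where
  "dual_code C = {x. \<forall>y\<in>C. scalar_product x y = 0}"

definition self_dual :: "(bit ^ 'n) set \<Rightarrow> bool" where
  "self_dual C \<longleftrightarrow> C = dual_code C"

definition doubly_even_self_dual :: "(bit ^ 'n) set \<Rightarrow> bool" where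
  "doubly_even_self_dual C \<longleftrightarrow> self_dual C \<and> (\<forall>x\<in>C. weight x mod 4 = 0)"

definition singly_even_self_dual :: "(bit ^ 'n) set \<Rightarrow> bool" where
  "singly_even_self_dual C \<longleftrightarrow> self_dual C \<and> (\<exists>x\<in>C. weight x mod 4 = 2)"

definition extremal :: "(bit ^ 'n) set \<Rightarrow> bool" where
  "extremal C \<longleftrightarrow> self_dual C \<and>
     min_weight C =
       (if CARD('n) mod 24 = 22 then 4 * (CARD('n) div 24) + 6 else 4 * (CARD('n) div 24) + 4)"

definition doubly_even_subcode :: "(bit ^ 'n) set \<Rightarrow> (bit ^ 'n) set" where
  "doubly_even_subcode C = {x \<in> C. weight x mod 4 = 0}"

definition shadow :: "(bit ^ 'n) set \<Rightarrow> (bit ^ 'n) set" where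
  "shadow C = dual_code (doubly_even_subcode C) - C"

text \<open>Stated over the reals to avoid truncated subtraction and division.\<close>

definition s_extremal :: "(bit ^ 'n) set \<Rightarrow> bool" where
  "s_extremal C \<longleftrightarrow> singly_even_self_dual C \<and>
     \<not> (CARD('n) mod 24 = 22 \<and> min_weight C = 4 * (CARD('n) div 24) + 6) \<and>
     real (min_weight (shadow C)) = real CARD('n) / 2 + 4 - 2 * real (min_weight C)"

definition hamming_sphere :: "bit ^ 'n \<Rightarrow> nat \<Rightarrow> (bit ^ 'n) set" where
  "hamming_sphere c r = {x. hamming_dist c x \<le> r}"

definition covering_radius :: "(bit ^ 'n) set \<Rightarrow> nat" where
  "covering_radius C = (LEAST R. (\<Union>c\<in>C. hamming_sphere c R) = UNIV)"

definition weight_count :: "(bit ^ 'n) set \<Rightarrow> nat \<Rightarrow> nat" where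
  "weight_count C i = card {x \<in> C. weight x = i}"

definition delsarte_bound :: "(bit ^ 'n) set \<Rightarrow> nat" where
  "delsarte_bound C = card {i. weight_count (dual_code C) i \<noteq> 0 \<and> 0 < i \<and> i \<le> CARD('n)}"

definition meets_delsarte_bound :: "(bit ^ 'n) set \<Rightarrow> bool" where
  "meets_delsarte_bound C \<longleftrightarrow> covering_radius C = delsarte_bound C"

end

theory Submission
  imports Defs
begin

text \<open>
  All three statements reduce to one: a doubly even self-dual code \<open>D\<close> of length
  \<open>n = 24 k + 16\<close> with minimum weight at least \<open>4 k + 4\<close> has, for \<open>k \<ge> 148\<close>, no coset
  \<open>v + D\<close> all of whose weights are at least \<open>4 k + 4\<close> (lemma \<open>no_distant_coset\<close>).
  Covering radius \<open>4 k + 4\<close> provides such a \<open>v\<close> directly.  For an s-extremal singly even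
  code \<open>C\<close> with doubly even part \<open>C\<^sub>0\<close> the shadow has minimum weight \<open>4 k + 4\<close>, and for a
  shadow vector \<open>s\<close> the code \<open>D = C\<^sub>0 \<union> (s + C\<^sub>0)\<close> is doubly even and self-dual; the coset
  of \<open>D\<close> through a codeword in \<open>C - C\<^sub>0\<close> lies in the union of \<open>C\<close> and its shadow and does
  not contain \<open>0\<close>.

  Suppose \<open>D\<close> and \<open>v\<close> exist, and let \<open>A\<^sub>j\<close> be the number of codewords of weight \<open>4 j\<close> and
  \<open>S\<^sub>j\<close> the same number with codewords \<open>e\<close> counted with the sign \<open>(-1)\<close> to the power
  \<open>v \<cdot> e\<close>, so that \<open>S\<^sub>j \<le> A\<^sub>j\<close>.  Both sequences can be computed as far as they are needed.

  \<^item> By the MacWilliams identity, large weights in the coset make \<open>\<Sum>j. S\<^sub>j x\<^sup>j\<close> divisible by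
    \<open>(1 - x)\<close> to the power \<open>4 k + 4\<close>, so \<open>\<Sum>j. S\<^sub>j p(j)\<close> vanishes for every polynomial \<open>p\<close>
    of degree at most \<open>4 k + 3\<close>.  Only the \<open>4 k + 5\<close> indices
    \<open>0, k + 1, \<dots>, 5 k + 3, 6 k + 4\<close> can carry a codeword.  Taking for \<open>p\<close> the polynomial
    that vanishes at all of them except \<open>0\<close> and \<open>k + 2\<close> gives \<open>S\<close> at \<open>k + 2\<close> as a quotient of
    factorials (lemma \<open>signed_coefficient\<close>).

  \<^item> By Gleason's theorem \<open>\<Sum>j. A\<^sub>j x\<^sup>j\<close> is a combination of products of powers of
    \<open>\<phi> = 1 + 14 x + x\<^sup>2\<close> and \<open>\<psi> = x (1 - x)\<^sup>4\<close>.  Put \<open>t = \<psi> / \<phi>\<^sup>3\<close>.  Divided by the power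
    of \<open>\<phi>\<close> of the same length, the enumerator is a polynomial of degree at most \<open>k\<close> in \<open>t\<close>,
    and the formal residue of \<open>t\<^sup>i dt\<close> vanishes unless \<open>i = -1\<close>.  This yields linear
    relations for \<open>A\<close> (lemma \<open>invariant_poly_residue\<close>), the first two of which determine \<open>A\<close>
    at \<open>k + 1\<close> and \<open>k + 2\<close>.

  Up to a common quotient of factorials, \<open>S - A\<close> at \<open>k + 2\<close> is then a polynomial in \<open>k\<close> whose
  Taylor coefficients at \<open>148\<close> are all positive, which contradicts \<open>S \<le> A\<close>.
\<close>

section \<open>Characters and the MacWilliams identity\<close>

lemma UNIV_bit: "(UNIV :: bit set) = {0, 1}"
  using bit_not_zero_iff by blast

instance bit :: finite
  by standard (simp add: UNIV_bit)

definition bit_sign :: "bit \<Rightarrow> 'a :: field_char_0" where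
  "bit_sign b = (if b = 0 then 1 else -1)"

definition character :: "bit ^ 'n \<Rightarrow> bit ^ 'n \<Rightarrow> 'a :: field_char_0" where
  "character v x = bit_sign (scalar_product v x)"

lemma scalar_product_commute: "scalar_product x y = scalar_product y (x :: bit ^ 'n)"
  by (simp only: scalar_product_def mult.commute)

lemma scalar_product_add_right:
  "scalar_product x (y + z) = scalar_product x y + scalar_product x (z :: bit ^ 'n)"
  by (simp only: scalar_product_def vector_add_component distrib_left sum.distrib)

lemma scalar_product_add_left:
  "scalar_product (y + z) x = scalar_product y x + scalar_product z (x :: bit ^ 'n)"
  by (simp only: scalar_product_def vector_add_component distrib_right sum.distrib)

lemma scalar_product_zero [simp]:
  "scalar_product x 0 = (0 :: bit)" "scalar_product 0 x = (0 :: bit)"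
  by (simp_all add: scalar_product_def)

lemma bit_add_self [simp]: "b + b = (0 :: bit)"
  by (cases b) simp_all

lemma bit_add_eq_0_iff [simp]: "a + b = (0 :: bit) \<longleftrightarrow> a = b"
  by (cases a; cases b) simp_all

lemma vec_add_self [simp]: "x + x = (0 :: bit ^ 'n)"
  by (simp add: vec_eq_iff)

lemma vec_add_left_cancel [simp]: "x + (x + y) = (y :: bit ^ 'n)"
  by (simp add: add.assoc [symmetric])

lemma bit_sign_add: "bit_sign (a + b) = bit_sign a * bit_sign b"
  by (cases a; cases b) (simp_all add: bit_sign_def)

lemma bit_sign_sum: "finite A \<Longrightarrow> bit_sign (sum f A) = (\<Prod>i\<in>A. bit_sign (f i))"
proof (induction A rule: finite_induct)
  case empty
  show ?case
    by (simp add: bit_sign_def)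
qed (simp only: sum.insert prod.insert bit_sign_add simp_thms)

lemma character_add: "character v (x + y) = character v x * character v y"
  by (simp only: character_def scalar_product_add_right bit_sign_add)

lemma character_commute: "character v x = character x v"
  by (simp only: character_def scalar_product_commute)

lemma character_zero [simp]: "character v 0 = 1" "character 0 v = 1"
  by (simp_all add: character_def bit_sign_def)

lemma character_conv_prod: "character v x = (\<Prod>i\<in>UNIV. bit_sign (v $ i * x $ i))"
  by (simp only: character_def scalar_product_def bit_sign_sum finite)

lemma weight_zero [simp]: "weight 0 = 0"
  by (simp add: weight_def)

lemma weight_le: "weight (x :: bit ^ 'n) \<le> CARD('n)"
  unfolding weight_def by (intro card_mono) auto

lemma weight_eq_0_iff [simp]: "weight x = 0 \<longleftrightarrow> x = 0"
  by (auto simp: weight_def vec_eq_iff)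

lemma prod_weight:
  fixes a b :: "'a :: comm_semiring_1" and x :: "bit ^ 'n"
  shows "(\<Prod>i\<in>UNIV. if x $ i = 0 then a else b) = a ^ (CARD('n) - weight x) * b ^ weight x"
proof -
  have eq: "{i. x $ i = 0} = UNIV - {i. x $ i \<noteq> 0}"
    by auto
  have "card {i. x $ i = 0} = CARD('n) - weight x"
    unfolding eq weight_def by (rule card_Diff_subset) auto
  then show ?thesis
    by (simp add: prod.If_cases weight_def Collect_neg_eq [symmetric])
qed

lemma sum_prod_coordinates:
  fixes h :: "'n :: finite \<Rightarrow> bit \<Rightarrow> 'a :: comm_semiring_1"
  shows "(\<Sum>z\<in>UNIV. \<Prod>i\<in>UNIV. h i (z $ i)) = (\<Prod>i\<in>UNIV. h i 0 + h i 1)"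
proof -
  have "(\<Prod>i\<in>UNIV. h i 0 + h i 1) = (\<Prod>i\<in>UNIV. \<Sum>b\<in>UNIV. h i b)"
    by (simp add: UNIV_bit)
  also have "\<dots> = (\<Sum>g\<in>PiE UNIV (\<lambda>_. UNIV). \<Prod>i\<in>UNIV. h i (g i))"
    by (rule prod_sum_PiE) auto
  also have "\<dots> = (\<Sum>z\<in>UNIV. \<Prod>i\<in>UNIV. h i (z $ i))"
    by (rule sum.reindex_bij_witness [of _ vec_nth vec_lambda]) auto
  finally show ?thesis ..
qed

text \<open>
  The summand is a product over the coordinates, so the sum over all vectors factors into a
  product of sums over the two values of one coordinate.
\<close>

lemma sum_character_power_weight:
  fixes t :: "'a :: field_char_0" and e :: "bit ^ 'n"
  shows "(\<Sum>z\<in>UNIV. character e z * t ^ weight z) = (1 + t) ^ (CARD('n) - weight e) * (1 - t) ^ weight e"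
proof -
  define h where "h i b = bit_sign (e $ i * b) * (if b = 0 then 1 else t)" for i b
  have "(\<Sum>z\<in>UNIV. character e z * t ^ weight z) = (\<Sum>z\<in>UNIV. \<Prod>i\<in>UNIV. h i (z $ i))"
    by (simp only: h_def character_conv_prod prod.distrib prod_weight power_one mult_1_left)
  also have "\<dots> = (\<Prod>i\<in>UNIV. if e $ i = 0 then 1 + t else 1 - t)"
    unfolding sum_prod_coordinates by (intro prod.cong) (auto simp: h_def bit_sign_def)
  finally show ?thesis
    by (simp add: prod_weight)
qed

definition linear_code :: "(bit ^ 'n) set \<Rightarrow> bool" where
  "linear_code E \<longleftrightarrow> 0 \<in> E \<and> (\<forall>x\<in>E. \<forall>y\<in>E. x + y \<in> E)"

lemma sum_translate:
  fixes E :: "(bit ^ 'n) set"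
  assumes "linear_code E" "v \<in> E"
  shows "(\<Sum>e\<in>E. f (v + e)) = (\<Sum>e\<in>E. f e)"
  by (rule sum.reindex_bij_witness [of _ "\<lambda>e. v + e" "\<lambda>e. v + e"])
     (use assms in \<open>auto simp: linear_code_def\<close>)

text \<open>
  Orthogonality: if some codeword has sign \<open>-1\<close>, translation by it negates the sum.
\<close>

lemma sum_character:
  fixes E :: "(bit ^ 'n) set"
  assumes "linear_code E"
  shows "(\<Sum>e\<in>E. character w e) = (if w \<in> dual_code E then of_nat (card E) else 0 :: 'a :: field_char_0)"
proof (cases "w \<in> dual_code E")
  case True
  then show ?thesis
    by (simp add: character_def dual_code_def bit_sign_def)
next
  case False
  then obtain u where u: "u \<in> E" "character w u = (-1 :: 'a)"
    by (auto simp: dual_code_def character_def bit_sign_def)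
  have "(\<Sum>e\<in>E. character w e) = (\<Sum>e\<in>E. character w (u + e) :: 'a)"
    using assms u by (simp add: sum_translate)
  also have "\<dots> = - (\<Sum>e\<in>E. character w e)"
    using u by (simp add: character_add sum_negf)
  finally have "2 * (\<Sum>e\<in>E. character w e :: 'a) = 0"
    by (simp add: eq_neg_iff_add_eq_0)
  with False show ?thesis
    by simp
qed

text \<open>
  The coset version of the identity.  Expanding each factor
  \<open>(1 + t) ^ (n - wt e) * (1 - t) ^ wt e\<close> as a character sum over the whole space and summing over
  \<open>e\<close> first leaves, by orthogonality, only the vectors in the coset \<open>v + dual_code E\<close>.
\<close>

theorem macwilliams:
  fixes E :: "(bit ^ 'n) set" and t :: "'a :: field_char_0"
  assumes "linear_code E"
  shows "(\<Sum>e\<in>E. character v e * (1 + t) ^ (CARD('n) - weight e) * (1 - t) ^ weight e) =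
         of_nat (card E) * (\<Sum>z | v + z \<in> dual_code E. t ^ weight z)"
proof -
  have "(\<Sum>e\<in>E. character v e * (1 + t) ^ (CARD('n) - weight e) * (1 - t) ^ weight e) =
        (\<Sum>e\<in>E. \<Sum>z\<in>UNIV. character (v + z) e * t ^ weight z)"
    by (simp only: mult.assoc sum_character_power_weight [symmetric] sum_distrib_left
          character_add character_commute [of "v + _"] character_commute [of v] mult.left_commute)
  also have "\<dots> = (\<Sum>z\<in>UNIV. (\<Sum>e\<in>E. character (v + z) e) * t ^ weight z)"
    by (subst sum.swap) (simp add: sum_distrib_right)
  also have "\<dots> = (\<Sum>z\<in>UNIV. if v + z \<in> dual_code E then of_nat (card E) * t ^ weight z else 0)"
    by (intro sum.cong) (auto simp: sum_character [OF assms])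
  also have "\<dots> = of_nat (card E) * (\<Sum>z | v + z \<in> dual_code E. t ^ weight z)"
    by (simp add: sum.If_cases sum_distrib_left)
  finally show ?thesis .
qed

text \<open>
  At \<open>t = 1\<close> only the zero codeword contributes to the left-hand side of the identity.
\<close>

lemma card_dual_code:
  fixes E :: "(bit ^ 'n) set"
  assumes "linear_code E"
  shows "card E * card (dual_code E) = 2 ^ CARD('n)"
proof -
  have "(\<Sum>e\<in>E. 2 ^ (CARD('n) - weight e) * 0 ^ weight e :: real) =
        (\<Sum>e\<in>{0 :: bit ^ 'n}. 2 ^ (CARD('n) - weight e) * 0 ^ weight e)"
    by (rule sum.mono_neutral_right) (use assms in \<open>auto simp: linear_code_def power_0_left\<close>)
  then have "real (card E * card (dual_code E)) = real (2 ^ CARD('n))"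
    using macwilliams [OF assms, of 0 "1 :: real"] by simp
  then show ?thesis
    by (simp only: of_nat_eq_iff)
qed

section \<open>Invariant polynomials and Gleason's theorem\<close>

text \<open>
  The points excluded are the real zeros of \<open>\<psi> (y\<^sup>4)\<close>; the rest is mapped into itself by
  \<open>y \<mapsto> (1 - y) / (1 + y)\<close> and is infinite, so polynomial identities may be tested on it.
\<close>

definition punctured_line :: "real set" where
  "punctured_line = UNIV - {0, 1, -1}"

lemma infinite_punctured_line: "infinite punctured_line"
  unfolding punctured_line_def by (intro Diff_infinite_finite) (auto simp: infinite_UNIV_char_0)

text \<open>
  The substitution that the MacWilliams transform induces on the variable of a weight enumerator.
\<close>

definition cayley :: "real \<Rightarrow> real" where
  "cayley y = (1 - y) / (1 + y)"

lemma poly_eq_if_infinite: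
  fixes P Q :: "real poly"
  assumes "infinite S" "\<And>x. x \<in> S \<Longrightarrow> poly P x = poly Q x"
  shows "P = Q"
proof (rule ccontr)
  assume "P \<noteq> Q"
  then have "finite {x. poly (P - Q) x = 0}"
    by (intro poly_roots_finite) simp
  moreover have "S \<subseteq> {x. poly (P - Q) x = 0}"
    using assms by auto
  ultimately show False
    using assms(1) finite_subset by blast
qed

lemma poly_eq_if_eq_fourth_powers:
  fixes P Q :: "real poly"
  assumes "\<And>y. y \<in> punctured_line \<Longrightarrow> poly P (y ^ 4) = poly Q (y ^ 4)"
  shows "P = Q"
proof -
  have "pcompose P (monom 1 4) = pcompose Q (monom 1 4)"
    by (rule poly_eq_if_infinite [OF infinite_punctured_line])
       (simp add: assms poly_pcompose poly_monom)
  then have "pcompose (P - Q) (monom 1 4) = 0"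
    by (simp add: pcompose_diff)
  then show ?thesis
    by (simp add: pcompose_eq_0_iff degree_monom_eq)
qed

lemma poly_eq_sum_coeff:
  fixes P :: "real poly"
  assumes "degree P \<le> N"
  shows "poly P x = (\<Sum>i\<le>N. coeff P i * x ^ i)"
  unfolding poly_altdef using assms
  by (intro sum.mono_neutral_left) (auto simp: coeff_eq_0)

text \<open>
  Since \<open>y \<mapsto> y\<^sup>4\<close> is unramified at \<open>1\<close>, it preserves the order of vanishing there.
\<close>

lemma power_dvd_if_fourth_powers:
  fixes P R :: "real poly"
  assumes "\<And>y. y \<in> punctured_line \<Longrightarrow> poly P (y ^ 4) = (1 - y) ^ r * poly R y"
  shows "[:1, -1:] ^ r dvd P"
proof (cases "P = 0")
  case False
  (* If s < r, cancelling the common factor (1 - y) ^ s and putting y = 1 makes the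
     cofactor Q vanish at 1, against the choice of s. *)
  define s where "s = order 1 P"
  obtain Q where Q: "P = [:-1, 1:] ^ s * Q" "\<not> [:-1, 1:] dvd Q"
    using order_decomp [OF False, of 1] unfolding s_def by auto
  have neg: "[:1, -1:] = smult (-1) [:-1, 1 :: real:]"
    by simp
  have "r \<le> s"
  proof (rule ccontr)
    assume "\<not> r \<le> s"
    then obtain d where d: "r = s + Suc d"
      by (metis add_Suc_right less_imp_Suc_add not_le)
    have "[:-1, -1, -1, -1:] ^ s * pcompose Q (monom 1 4) = [:1, -1:] ^ Suc d * R"
    proof (rule poly_eq_if_infinite [OF infinite_punctured_line])
      fix y assume y: "y \<in> punctured_line"
      have "y ^ 4 - 1 = (1 - y) * (-1 - y - y ^ 2 - y ^ 3)"
        by algebra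
      then have "poly P (y ^ 4) = (1 - y) ^ s * ((-1 - y - y ^ 2 - y ^ 3) ^ s * poly Q (y ^ 4))"
        by (simp add: Q(1) poly_power power_mult_distrib)
      moreover have "poly P (y ^ 4) = (1 - y) ^ s * ((1 - y) ^ Suc d * poly R y)"
        using assms [OF y] by (simp add: d power_add)
      ultimately have "(1 - y) ^ s * ((-1 - y - y ^ 2 - y ^ 3) ^ s * poly Q (y ^ 4)) =
          (1 - y) ^ s * ((1 - y) ^ Suc d * poly R y)"
        by (rule subst)
      moreover have "(1 - y) ^ s \<noteq> 0"
        using y by (simp add: punctured_line_def)
      ultimately have "(-1 - y - y ^ 2 - y ^ 3) ^ s * poly Q (y ^ 4) = (1 - y) ^ Suc d * poly R y"
        unfolding mult_cancel_left by blast
      moreover have "-1 - y - y ^ 2 - y ^ 3 = poly [:-1, -1, -1, -1:] y"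
        by (simp add: algebra_simps power2_eq_square power3_eq_cube)
      ultimately show "poly ([:-1, -1, -1, -1:] ^ s * pcompose Q (monom 1 4)) y = poly ([:1, -1:] ^ Suc d * R) y"
        by (simp only: poly_mult poly_power poly_pcompose poly_monom) simp
    qed
    then have "poly ([:-1, -1, -1, -1:] ^ s * pcompose Q (monom 1 4)) 1 = poly ([:1, -1:] ^ Suc d * R) 1"
      by simp
    then have "poly Q 1 = 0"
      by (simp add: poly_power poly_pcompose poly_monom)
    with Q(2) show False
      by (simp add: poly_eq_0_iff_dvd)
  qed
  then have "[:-1, 1:] ^ r dvd P"
    using Q(1) by (metis dvd_mult2 le_imp_power_dvd)
  then show ?thesis
    unfolding neg smult_power by (rule smult_dvd) simp
qed auto

text \<open>
  The conditions that self-duality imposes on the weight enumerator of a doubly even code of length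
  \<open>8 m\<close>, with \<open>x = y\<^sup>4\<close> as the variable: the factor \<open>16 ^ m\<close> is the number of codewords.
\<close>

definition invariant_poly :: "nat \<Rightarrow> real poly \<Rightarrow> bool" where
  "invariant_poly m P \<longleftrightarrow> degree P \<le> 2 * m \<and>
     (\<forall>y\<in>punctured_line. 16 ^ m * poly P (y ^ 4) = (1 + y) ^ (8 * m) * poly P (cayley y ^ 4))"

text \<open>
  The generators \<open>\<phi>\<close> and \<open>\<psi>\<close> of Gleason's ring: the enumerator of the extended Hamming
  code, of length \<open>8\<close>, and an invariant of length \<open>24\<close> without constant term.
\<close>

definition gleason_phi :: "real poly" where
  "gleason_phi = [:1, 14, 1:]"

definition gleason_psi :: "real poly" where
  "gleason_psi = [:0, 1:] * [:1, -1:] ^ 4"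

lemma cayley_in_punctured_line: "y \<in> punctured_line \<Longrightarrow> cayley y \<in> punctured_line"
  by (auto simp: punctured_line_def cayley_def field_simps)

lemma invariant_poly_one: "invariant_poly 0 1"
  by (simp add: invariant_poly_def)

lemma invariant_poly_mult:
  assumes "invariant_poly m P" "invariant_poly l Q"
  shows "invariant_poly (m + l) (P * Q)"
proof -
  have "degree (P * Q) \<le> 2 * (m + l)"
    using assms degree_mult_le [of P Q] by (simp add: invariant_poly_def)
  moreover have "16 ^ (m + l) * poly (P * Q) (y ^ 4) = (1 + y) ^ (8 * (m + l)) * poly (P * Q) (cayley y ^ 4)"
    if y: "y \<in> punctured_line" for y
  proof -
    have "16 ^ (m + l) * poly (P * Q) (y ^ 4) = (16 ^ m * poly P (y ^ 4)) * (16 ^ l * poly Q (y ^ 4))"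
      by (simp add: power_add)
    also have "\<dots> = ((1 + y) ^ (8 * m) * poly P (cayley y ^ 4)) * ((1 + y) ^ (8 * l) * poly Q (cayley y ^ 4))"
      using assms y by (simp add: invariant_poly_def)
    finally show ?thesis
      by (simp add: power_add algebra_simps)
  qed
  ultimately show ?thesis
    by (simp add: invariant_poly_def)
qed

lemma invariant_poly_power: "invariant_poly m P \<Longrightarrow> invariant_poly (m * j) (P ^ j)"
proof (induction j)
  case (Suc j)
  then show ?case
    using invariant_poly_mult [of m P "m * j" "P ^ j"] by simp
qed (simp add: invariant_poly_one)

lemma invariant_poly_diff_smult:
  assumes "invariant_poly m P" "invariant_poly m Q"
  shows "invariant_poly m (P - smult c Q)"
  using assms unfolding invariant_poly_def
  by (auto simp: algebra_simps intro!: degree_diff_le)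

lemma invariant_phi: "invariant_poly 1 gleason_phi"
proof -
  have "16 * poly gleason_phi (y ^ 4) = (1 + y) ^ 8 * poly gleason_phi (cayley y ^ 4)"
    if "y \<in> punctured_line" for y
  proof -
    define w where "w = inverse (1 + y)"
    have w: "(1 + y) * w = 1"
      using that by (simp add: w_def punctured_line_def eq_neg_iff_add_eq_0 add.commute)
    show ?thesis
      unfolding cayley_def divide_inverse w_def [symmetric] gleason_phi_def
      using w by simp algebra
  qed
  then show ?thesis
    by (simp add: invariant_poly_def) (simp add: gleason_phi_def)
qed

lemma degree_psi: "degree gleason_psi = 5"
  by (simp add: gleason_psi_def degree_mult_eq degree_power_eq)

lemma poly_psi: "poly gleason_psi x = x * (1 - x) ^ 4"
  by (simp add: gleason_psi_def poly_power)

lemma psi_nonzero: "y \<in> punctured_line \<Longrightarrow> poly gleason_psi (y ^ 4) \<noteq> 0"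
proof -
  assume y: "y \<in> punctured_line"
  have "(y\<^sup>2 - 1) * (y\<^sup>2 + 1) \<noteq> 0"
    using y by (auto simp: punctured_line_def power2_eq_1_iff add_eq_0_iff) (metis not_one_le_zero zero_le_power2 add_increasing neg_le_0_iff_le le_minus_one_simps(3))
  moreover have "(y\<^sup>2 - 1) * (y\<^sup>2 + 1) = y ^ 4 - 1"
    by algebra
  ultimately show ?thesis
    using y by (auto simp: poly_psi punctured_line_def)
qed

lemma invariant_psi_eq:
  assumes "y \<in> punctured_line"
  shows "16 ^ 3 * poly gleason_psi (y ^ 4) = (1 + y) ^ 24 * poly gleason_psi (cayley y ^ 4)"
proof -
  (* Writing 1 / (1 + y) as w with (1 + y) * w = 1 turns the claim into a polynomial identity. *)
  define w where "w = inverse (1 + y)"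
  have w: "(1 + y) * w = 1"
    using assms by (simp add: w_def punctured_line_def eq_neg_iff_add_eq_0 add.commute)
  have "(1 + y) ^ 24 * poly gleason_psi (cayley y ^ 4) =
        (1 + y) ^ 4 * ((1 - y) * ((1 + y) * w)) ^ 4 * ((1 + y) ^ 4 - ((1 - y) * ((1 + y) * w)) ^ 4) ^ 4"
    unfolding cayley_def divide_inverse w_def [symmetric] poly_psi by algebra
  also have "\<dots> = (1 + y) ^ 4 * (1 - y) ^ 4 * ((1 + y) ^ 4 - (1 - y) ^ 4) ^ 4"
    by (simp add: w)
  also have "(1 + y) ^ 4 - (1 - y) ^ 4 = 8 * (y * (1 + y\<^sup>2))"
    by algebra
  also have "(1 + y) ^ 4 * (1 - y) ^ 4 * (8 * (y * (1 + y\<^sup>2))) ^ 4 =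
             8 ^ 4 * (y ^ 4 * (((1 + y) * (1 - y)) * (1 + y\<^sup>2)) ^ 4)"
    by (simp only: power_mult_distrib mult_ac)
  also have "(1 + y) * (1 - y) * (1 + y\<^sup>2) = 1 - y ^ 4"
    by algebra
  finally show ?thesis
    by (simp add: poly_psi)
qed

text \<open>
  Reversal \<open>y \<mapsto> 1 / y\<close> is the composition of the Cayley substitution, a change of sign and the
  Cayley substitution again, and fourth powers do not see the sign.
\<close>

lemma invariant_poly_palindromic:
  assumes "invariant_poly m P"
  shows "P = (\<Sum>i\<le>2 * m. monom (coeff P i) (2 * m - i))"
proof (rule poly_eq_if_eq_fourth_powers)
  fix y assume y: "y \<in> punctured_line"
  define s where "s = cayley y"
  have ne: "1 + y \<noteq> 0" "y \<noteq> 0"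
    using y by (auto simp: punctured_line_def)
  have inv: "16 ^ m * poly P (z ^ 4) = (1 + z) ^ (8 * m) * poly P (cayley z ^ 4)"
    if "z \<in> punctured_line" for z
    using assms that by (simp add: invariant_poly_def)
  have s: "- s \<in> punctured_line"
    using cayley_in_punctured_line [OF y] by (auto simp: s_def punctured_line_def)
  have s': "1 - s = 2 * y / (1 + y)" "1 + s = 2 / (1 + y)"
    using ne by (auto simp: s_def cayley_def field_simps)
  have "cayley (- s) = (2 / (1 + y)) / (2 * y / (1 + y))"
    unfolding s' [symmetric] by (simp add: cayley_def)
  also have "\<dots> = 1 / y"
  proof -
    have "(2 / w) / (2 * y / w) = 1 / y" if "w \<noteq> 0" for w
      using that ne by (simp add: field_simps)
    then show ?thesis
      using ne by blast
  qed
  finally have "cayley (- s) = 1 / y" .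
  with s'(1) have "16 ^ m * poly P (s ^ 4) = (2 * y / (1 + y)) ^ (8 * m) * poly P ((1 / y) ^ 4)"
    using inv [OF s] by simp
  have "16 ^ m * (16 ^ m * poly P (y ^ 4)) = 16 ^ m * ((1 + y) ^ (8 * m) * poly P (s ^ 4))"
    using inv [OF y] by (simp add: s_def)
  also have "\<dots> = (1 + y) ^ (8 * m) * (16 ^ m * poly P (s ^ 4))"
    by (simp only: mult.left_commute)
  also have "16 ^ m * poly P (s ^ 4) = (2 * y / (1 + y)) ^ (8 * m) * poly P ((1 / y) ^ 4)"
    by fact
  also have "(1 + y) ^ (8 * m) * \<dots> = ((1 + y) * (2 * y / (1 + y))) ^ (8 * m) * poly P ((1 / y) ^ 4)"
    by (simp only: power_mult_distrib mult.assoc)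
  also have "(1 + y) * (2 * y / (1 + y)) = 2 * y"
    using ne by simp
  also have "(2 * y) ^ (8 * m) = ((2 * y) ^ 8) ^ m"
    by (rule power_mult)
  also have "(2 * y) ^ 8 = 16 * 16 * (y ^ 4)\<^sup>2"
    by algebra
  also have "\<dots> ^ m = 16 ^ m * 16 ^ m * (y ^ 4) ^ (2 * m)"
    by (simp only: power_mult_distrib power_mult)
  finally have "poly P (y ^ 4) = (y ^ 4) ^ (2 * m) * poly P (1 / y ^ 4)"
    by (simp add: power_divide)
  also have "poly P (1 / y ^ 4) = (\<Sum>i\<le>2 * m. coeff P i * (1 / y ^ 4) ^ i)"
    using assms by (intro poly_eq_sum_coeff) (simp add: invariant_poly_def)
  also have "(y ^ 4) ^ (2 * m) * \<dots> = (\<Sum>i\<le>2 * m. coeff P i * (y ^ 4) ^ (2 * m - i))"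
    unfolding sum_distrib_left
    using ne by (intro sum.cong) (auto simp: power_diff power_divide field_simps)
  finally show "poly P (y ^ 4) = poly (\<Sum>i\<le>2 * m. monom (coeff P i) (2 * m - i)) (y ^ 4)"
    by (simp add: poly_sum poly_monom)
qed

text \<open>
  The identity turns the coefficient of \<open>x ^ i\<close> into a multiple of
  \<open>(1 + y) ^ (8 m - 4 i) (1 - y) ^ (4 i)\<close>.  Without a constant term all of these are divisible by
  \<open>(1 - y)\<^sup>4\<close>, so a zero at \<open>x = 0\<close> forces a zero of order four at \<open>x = 1\<close>.
\<close>

lemma psi_dvd_if_coeff_0_eq_0:
  assumes inv: "invariant_poly m P" and zero: "coeff P 0 = 0"
  shows "gleason_psi dvd P"
proof -
  have "[:0, 1:] dvd P"
    using zero by (simp add: dvd_iff_poly_eq_0 poly_0_coeff_0)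
  moreover have "[:1, -1:] ^ 4 dvd P"
  proof (rule power_dvd_if_fourth_powers)
    fix y assume y: "y \<in> punctured_line"
    then have ne: "1 + y \<noteq> 0"
      by (auto simp: punctured_line_def)
    have "16 ^ m * poly P (y ^ 4) = (1 + y) ^ (8 * m) * poly P (cayley y ^ 4)"
      using inv y by (simp add: invariant_poly_def)
    also have "poly P (cayley y ^ 4) = (\<Sum>i\<le>2 * m. coeff P i * (cayley y ^ 4) ^ i)"
      using inv by (intro poly_eq_sum_coeff) (simp add: invariant_poly_def)
    also have "\<dots> = (\<Sum>i\<in>{1..2 * m}. coeff P i * (cayley y ^ 4) ^ i)"
      using zero by (intro sum.mono_neutral_right) (auto simp: Suc_le_eq)
    also have "(1 + y) ^ (8 * m) * \<dots> =
               (\<Sum>i\<in>{1..2 * m}. coeff P i * ((1 + y) ^ (8 * m - 4 * i) * (1 - y) ^ (4 * i)))"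
      unfolding sum_distrib_left cayley_def
    proof (intro sum.cong refl)
      fix i assume "i \<in> {1..2 * m}"
      then have "(1 + y) ^ (8 * m) = (1 + y) ^ (8 * m - 4 * i) * (1 + y) ^ (4 * i)"
        by (simp flip: power_add)
      then show "(1 + y) ^ (8 * m) * (coeff P i * (((1 - y) / (1 + y)) ^ 4) ^ i) =
                 coeff P i * ((1 + y) ^ (8 * m - 4 * i) * (1 - y) ^ (4 * i))"
        using ne by (simp add: power_divide flip: power_mult)
    qed
    also have "\<dots> = (1 - y) ^ 4 *
               (\<Sum>i\<in>{1..2 * m}. coeff P i * ((1 + y) ^ (8 * m - 4 * i) * (1 - y) ^ (4 * (i - 1))))"
      unfolding sum_distrib_left
    proof (intro sum.cong refl)
      fix i assume "i \<in> {1..2 * m}"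
      then have "4 * i = 4 + 4 * (i - 1)"
        by auto
      then have "(1 - y) ^ (4 * i) = (1 - y) ^ 4 * (1 - y) ^ (4 * (i - 1))"
        by (metis power_add)
      then show "coeff P i * ((1 + y) ^ (8 * m - 4 * i) * (1 - y) ^ (4 * i)) =
          (1 - y) ^ 4 * (coeff P i * ((1 + y) ^ (8 * m - 4 * i) * (1 - y) ^ (4 * (i - 1))))"
        by simp
    qed
    finally show "poly P (y ^ 4) = (1 - y) ^ 4 * poly (smult (1 / 16 ^ m)
        (\<Sum>i\<in>{1..2 * m}. smult (coeff P i) ([:1, 1:] ^ (8 * m - 4 * i) * [:1, -1:] ^ (4 * (i - 1))))) y"
      by (simp add: poly_sum poly_power field_simps)
  qed
  (* x and (1 - x)^4 are coprime, with the Bezout identity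
     x (4 - 6 x + 4 x^2 - x^3) + (1 - x)^4 = 1. *)
  ultimately have "gleason_psi dvd [:0, 1:] * P" "gleason_psi dvd P * [:1, -1:] ^ 4"
    unfolding gleason_psi_def by (simp_all only: mult_dvd_mono dvd_refl)
  then have "gleason_psi dvd [:0, 1:] * P * [:4, -6, 4, -1:] + P * [:1, -1:] ^ 4"
    by (metis dvd_add dvd_mult2)
  also have "[:0, 1:] * P * [:4, -6, 4, -1:] + P * [:1, -1:] ^ 4 =
             ([:0, 1:] * [:4, -6, 4, -1:] + [:1, -1:] ^ 4) * P"
    by (simp only: distrib_left distrib_right mult_ac)
  also have "[:0, 1:] * [:4, -6, 4, -1 :: real:] + [:1, -1:] ^ 4 = 1"
    by (simp add: eval_nat_numeral one_pCons)
  finally show ?thesis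
    by simp
qed

text \<open>
  As \<open>\<psi>\<close> has degree \<open>5\<close> only, the degree bound for \<open>V\<close> needs one more unit: by reversal the
  vanishing constant term of \<open>\<psi> V\<close> forces its top coefficient to vanish too.
\<close>

lemma invariant_poly_div_psi:
  assumes inv: "invariant_poly m (gleason_psi * V)" and "V \<noteq> 0"
  shows "m \<ge> 3 \<and> invariant_poly (m - 3) V"
proof -
  define P where "P = gleason_psi * V"
  have degP: "degree P = 5 + degree V"
    unfolding P_def degree_psi [symmetric] using assms(2)
    by (intro degree_mult_eq) (auto simp: gleason_psi_def)
  have "coeff P (2 * m) = (\<Sum>i\<le>2 * m. coeff (monom (coeff P i) (2 * m - i)) (2 * m))"
    by (subst invariant_poly_palindromic [OF inv, folded P_def]) (simp add: coeff_sum)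
  also have "\<dots> = (\<Sum>i\<in>{0}. coeff (monom (coeff P i) (2 * m - i)) (2 * m))"
    by (rule sum.mono_neutral_right) (auto split: if_splits)
  also have "\<dots> = 0"
    by (simp add: P_def gleason_psi_def coeff_mult_0)
  finally have "degree P \<noteq> 2 * m"
    using degP by (metis add_is_0 degree_0 leading_coeff_0_iff zero_neq_numeral)
  with inv have deg: "degree V + 6 \<le> 2 * m"
    by (simp add: invariant_poly_def degP flip: P_def)
  then have m: "m \<ge> 3"
    by simp
  have "16 ^ (m - 3) * poly V (y ^ 4) = (1 + y) ^ (8 * (m - 3)) * poly V (cayley y ^ 4)"
    if y: "y \<in> punctured_line" for y
  proof -
    have "m = 3 + (m - 3)" "8 * m = 24 + 8 * (m - 3)"
      using m by auto
    then have "16 ^ m = 16 ^ 3 * (16 ^ (m - 3) :: real)" "(1 + y) ^ (8 * m) = (1 + y) ^ 24 * (1 + y) ^ (8 * (m - 3))"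
      by (metis power_add)+
    then have "(16 ^ 3 * poly gleason_psi (y ^ 4)) * (16 ^ (m - 3) * poly V (y ^ 4)) =
          ((1 + y) ^ 24 * poly gleason_psi (cayley y ^ 4)) * ((1 + y) ^ (8 * (m - 3)) * poly V (cayley y ^ 4))"
      using inv y by (simp add: invariant_poly_def mult_ac)
    then show ?thesis
      unfolding invariant_psi_eq [OF y, symmetric] using psi_nonzero [OF y] by simp
  qed
  then show ?thesis
    using m deg by (auto simp: invariant_poly_def)
qed

text \<open>
  Subtracting the right multiple of a power of \<open>\<phi>\<close> removes the constant term; the difference is
  divisible by \<open>\<psi>\<close> with a quotient of length smaller by \<open>24\<close>.  At length \<open>16\<close> there is no room
  for such a quotient, so the difference is zero.
\<close>

theorem gleason:
  assumes "invariant_poly (3 * k + 2) P"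
  shows "\<exists>a. P = (\<Sum>j\<le>k. smult (a j) (gleason_phi ^ (3 * (k - j) + 2) * gleason_psi ^ j))"
  using assms
proof (induction k arbitrary: P)
  case 0
  define U where "U = P - smult (coeff P 0) (gleason_phi ^ 2)"
  have inv: "invariant_poly 2 U"
    unfolding U_def using 0 invariant_poly_power [OF invariant_phi, of 2]
    by (intro invariant_poly_diff_smult) (simp_all add: numeral_2_eq_2)
  then obtain V where V: "U = gleason_psi * V"
    using psi_dvd_if_coeff_0_eq_0 [OF inv]
    by (auto simp: U_def gleason_phi_def coeff_mult_0 power2_eq_square elim: dvdE)
  (* A non-zero V would need m >= 3. *)
  have "U = 0"
    using invariant_poly_div_psi [of 2 V] inv V by fastforce
  then show ?case
    by (intro exI [of _ "\<lambda>_. coeff P 0"]) (simp add: U_def power2_eq_square)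
next
  case (Suc k)
  define m where "m = 3 * Suc k + 2"
  define U where "U = P - smult (coeff P 0) (gleason_phi ^ m)"
  have inv: "invariant_poly m U"
    unfolding U_def using Suc.prems invariant_poly_power [OF invariant_phi, of m]
    by (intro invariant_poly_diff_smult) (simp_all add: m_def)
  have "coeff (gleason_phi ^ m) 0 = 1"
    by (simp add: gleason_phi_def coeff_0_power)
  then obtain V where V: "U = gleason_psi * V"
    using psi_dvd_if_coeff_0_eq_0 [OF inv] by (auto simp: U_def elim: dvdE)
  have "invariant_poly (3 * k + 2) V"
  proof (cases "V = 0")
    case False
    then show ?thesis
      using invariant_poly_div_psi [of m V] inv V by (simp add: m_def)
  qed (simp add: invariant_poly_def)
  then obtain a where a: "V = (\<Sum>j\<le>k. smult (a j) (gleason_phi ^ (3 * (k - j) + 2) * gleason_psi ^ j))"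
    using Suc.IH by blast
  define b where "b j = (case j of 0 \<Rightarrow> coeff P 0 | Suc i \<Rightarrow> a i)" for j
  have "P = smult (coeff P 0) (gleason_phi ^ m) + gleason_psi * V"
    using V by (simp add: U_def algebra_simps)
  also have "gleason_psi * V = (\<Sum>j\<le>k. smult (b (Suc j)) (gleason_phi ^ (3 * (Suc k - Suc j) + 2) * gleason_psi ^ Suc j))"
    by (simp add: a b_def sum_distrib_left mult_ac)
  also have "smult (coeff P 0) (gleason_phi ^ m) + \<dots> =
      (\<Sum>j\<le>Suc k. smult (b j) (gleason_phi ^ (3 * (Suc k - j) + 2) * gleason_psi ^ j))"
    by (subst sum.atMost_Suc_shift) (simp add: b_def m_def)
  finally show ?case
    by blast
qed

section \<open>Linear relations between the coefficients\<close>

definition geometric_fps :: "real fps" where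
  "geometric_fps = inverse (1 - fps_X)"

lemma geometric_mult: "(1 - fps_X) * geometric_fps = 1"
  unfolding geometric_fps_def by (rule inverse_mult_eq_1') simp

lemma geometric_power_mult: "(1 - fps_X) ^ i * geometric_fps ^ (i + j) = geometric_fps ^ j"
  by (simp add: power_add mult.assoc [symmetric] power_mult_distrib [symmetric] geometric_mult)

lemma fps_deriv_geometric: "fps_deriv geometric_fps = geometric_fps ^ 2"
proof -
  have "0 = fps_deriv ((1 - fps_X) * geometric_fps)"
    by (simp only: geometric_mult fps_deriv_1)
  also have "\<dots> = (1 - fps_X) * fps_deriv geometric_fps - geometric_fps"
    by simp
  finally have eq: "(1 - fps_X) * fps_deriv geometric_fps = geometric_fps"
    by simp
  have "fps_deriv geometric_fps = ((1 - fps_X) * geometric_fps) * fps_deriv geometric_fps"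
    by (simp add: geometric_mult)
  also have "\<dots> = geometric_fps * ((1 - fps_X) * fps_deriv geometric_fps)"
    by (simp only: mult_ac)
  finally show ?thesis
    by (simp add: eq power2_eq_square)
qed

lemma nth_geometric_power: "fps_nth (geometric_fps ^ Suc N) i = real ((N + i) choose i)"
proof (induction N arbitrary: i)
  case 0
  have "inverse (1 - fps_X :: real fps) = Abs_fps (\<lambda>_. 1)"
    by (rule fps_inverse_one_minus_fps_X)
  then show ?case
    by (simp add: geometric_fps_def)
next
  case (Suc N)
  note IHN = Suc.IH
  define F where "F = geometric_fps ^ Suc (Suc N)"
  have F: "F - fps_X * F = geometric_fps ^ Suc N"
    using geometric_power_mult [of 1 "Suc N"] by (simp add: F_def algebra_simps)
  have nth: "fps_nth F i - (if i = 0 then 0 else fps_nth F (i - 1)) = real ((N + i) choose i)" for i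
    unfolding IHN [symmetric] F [symmetric] by simp
  have "fps_nth F i = real ((Suc N + i) choose i)"
  proof (induction i)
    case 0
    show ?case
      using nth [of 0] by simp
  next
    case (Suc i)
    show ?case
      using nth [of "Suc i"] Suc.IH by simp
  qed
  then show ?case
    by (simp add: F_def)
qed

definition phi_fps :: "real fps" where
  "phi_fps = fps_of_poly gleason_phi"

text \<open>
  With \<open>t = \<psi> / \<phi>\<^sup>3\<close>, the logarithmic derivative \<open>x t' / t\<close> is this cubic divided by
  \<open>(1 - x) \<phi>\<close>.
\<close>

definition log_deriv_fps :: "real fps" where
  "log_deriv_fps = fps_of_poly [:1, -33, -33, 1:]"

lemma phi_fps_eq: "phi_fps = 1 + 14 * fps_X + fps_X ^ 2"
  by (simp add: phi_fps_def gleason_phi_def fps_of_poly_pCons power2_eq_square algebra_simps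
        numeral_fps_const)

lemma log_deriv_fps_eq: "log_deriv_fps = 1 - 33 * fps_X - 33 * fps_X ^ 2 + fps_X ^ 3"
  by (simp add: log_deriv_fps_def fps_of_poly_pCons power2_eq_square power3_eq_cube algebra_simps
        numeral_fps_const)

lemma psi_fps_eq: "fps_of_poly gleason_psi = fps_X * (1 - fps_X) ^ 4"
proof -
  have "fps_of_poly [:1, -1 :: real:] = 1 - fps_X"
    by (simp add: fps_of_poly_pCons)
  then show ?thesis
    by (simp add: gleason_psi_def fps_of_poly_mult fps_of_poly_power)
qed

lemma fps_deriv_phi: "fps_deriv phi_fps = 14 + 2 * fps_X"
  by (simp add: phi_fps_eq power2_eq_square)

text \<open>
  Up to the factor \<open>-1\<close>, the series here is \<open>x ^ (r + 1)\<close> times the derivative of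
  \<open>t ^ (-r) / r\<close>, and a derivative has no residue.  In power series terms, \<open>t ^ (-r)\<close> is
  \<open>x ^ (-r) g\<close> with \<open>g = \<phi> ^ (3 r) / (1 - x) ^ (4 r)\<close>, and \<open>r g - x g'\<close> never has a term
  \<open>x ^ r\<close>.
\<close>

lemma residue_eq_0:
  assumes "r > 0"
  shows "fps_nth (phi_fps ^ (3 * r - 1) * log_deriv_fps * geometric_fps ^ (4 * r + 1)) r = 0"
proof -
  obtain q where q: "r = Suc q"
    using assms gr0_implies_Suc by blast
  define A where "A = phi_fps ^ (3 * r - 1)"
  define g where "g = phi_fps ^ (3 * r) * geometric_fps ^ (4 * r)"
  have phi: "phi_fps ^ (3 * r) = phi_fps * A"
  proof -
    have "3 * r = Suc (3 * r - 1)"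
      using assms by simp
    then show ?thesis
      unfolding A_def by (metis power_Suc)
  qed
  have geo: "geometric_fps ^ (4 * r) = (1 - fps_X) * geometric_fps ^ (4 * r + 1)"
    using geometric_power_mult [of 1 "4 * r"] by simp
  have dphi: "fps_deriv (phi_fps ^ (3 * r)) = fps_const (real r) * (3 * (14 + 2 * fps_X) * A)"
    by (simp add: fps_deriv_power fps_deriv_phi A_def numeral_fps_const mult_ac)
  have dgeo: "fps_deriv (geometric_fps ^ (4 * r)) = fps_const (real r) * (4 * geometric_fps ^ (4 * r + 1))"
  proof -
    have "fps_deriv (geometric_fps ^ (4 * r)) =
          fps_const (real (4 * r)) * (geometric_fps ^ (4 * r - 1) * geometric_fps ^ 2)"
      by (simp add: fps_deriv_power fps_deriv_geometric mult_ac)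
    also have "fps_const (real (4 * r)) = fps_const (real r) * 4"
      by (simp add: numeral_fps_const)
    also have "geometric_fps ^ (4 * r - 1) * geometric_fps ^ 2 = geometric_fps ^ (4 * r + 1)"
      using assms by (simp flip: power_add)
    finally show ?thesis
      by (simp only: mult.assoc)
  qed
  have "fps_const (real r) * g - fps_X * fps_deriv g =
        fps_const (real r) * (A * log_deriv_fps * geometric_fps ^ (4 * r + 1))"
    unfolding g_def fps_deriv_mult dphi dgeo unfolding phi geo unfolding phi_fps_eq log_deriv_fps_eq by algebra
  moreover have "fps_nth (fps_const (real r) * g - fps_X * fps_deriv g) r = 0"
    by (simp add: q)
  ultimately have "real r * fps_nth (A * log_deriv_fps * geometric_fps ^ (4 * r + 1)) r = 0"
    by (metis fps_mult_left_const_nth)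
  then show ?thesis
    using assms by (simp add: A_def)
qed

text \<open>
  In the notation above, \<open>P / \<phi> ^ (3 k + 2)\<close> is a polynomial of degree at most \<open>k\<close> in \<open>t\<close>.
  Multiplied by \<open>t ^ (- k - l - 1) dt\<close> it only produces exponents below \<open>-1\<close>, so the residue is
  zero; clearing denominators turns the residue into the coefficient of \<open>x ^ (k + l)\<close>.
\<close>

theorem invariant_poly_residue:
  assumes "invariant_poly (3 * k + 2) P" and "l > 0"
  shows "fps_nth (fps_of_poly P * (log_deriv_fps * phi_fps ^ (3 * l - 3)) * geometric_fps ^ (4 * (k + l) + 1)) (k + l) = 0"
proof -
  define Q where "Q = log_deriv_fps * phi_fps ^ (3 * l - 3) * geometric_fps ^ (4 * (k + l) + 1)"
  obtain a where a: "P = (\<Sum>j\<le>k. smult (a j) (gleason_phi ^ (3 * (k - j) + 2) * gleason_psi ^ j))"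
    using gleason [OF assms(1)] by blast
  have "fps_nth (phi_fps ^ (3 * (k - j) + 2) * (fps_of_poly gleason_psi) ^ j * Q) (k + l) = 0"
    if j: "j \<le> k" for j
  proof -
    define r where "r = k + l - j"
    have r: "r > 0" "k + l = j + r" "3 * (k - j) + 2 + (3 * l - 3) = 3 * r - 1"
      "4 * (k + l) + 1 = 4 * j + (4 * r + 1)"
      using j assms(2) by (auto simp: r_def)
    have "fps_of_poly gleason_psi ^ j = fps_X ^ j * (1 - fps_X) ^ (4 * j)"
      by (simp only: psi_fps_eq power_mult_distrib power_mult)
    then have "phi_fps ^ (3 * (k - j) + 2) * (fps_of_poly gleason_psi) ^ j * Q =
        fps_X ^ j * (phi_fps ^ (3 * (k - j) + 2 + (3 * l - 3)) * log_deriv_fps *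
          ((1 - fps_X) ^ (4 * j) * geometric_fps ^ (4 * (k + l) + 1)))"
      by (simp only: Q_def power_add mult_ac)
    also have "\<dots> = fps_X ^ j * (phi_fps ^ (3 * r - 1) * log_deriv_fps * geometric_fps ^ (4 * r + 1))"
      unfolding r(3,4) geometric_power_mult ..
    finally show ?thesis
      using residue_eq_0 [OF r(1)] by (simp add: r(2) fps_X_power_mult_nth)
  qed
  then have "fps_nth (fps_of_poly P * Q) (k + l) = 0"
    unfolding a fps_of_poly_sum
    by (simp add: sum_distrib_right fps_sum_nth fps_of_poly_smult fps_of_poly_mult fps_of_poly_power
          phi_fps_def mult.assoc)
  then show ?thesis
    by (simp add: Q_def mult_ac)
qed

section \<open>The second coefficient after the gap\<close>

lemma pochhammer_of_nat_fact: "fact (n + i) = fact n * pochhammer (real n + 1) i"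
  by (induction i) (simp_all add: pochhammer_Suc algebra_simps)

text \<open>
  The numerator of a coefficient of \<open>Q / (1 - x) ^ (N + 1)\<close> over the common denominator of the
  binomial coefficients that occur in it.
\<close>

definition pochhammer_sum :: "real poly \<Rightarrow> nat \<Rightarrow> real \<Rightarrow> real \<Rightarrow> real" where
  "pochhammer_sum Q d a b = (\<Sum>i\<le>d. coeff Q i * (pochhammer a (d - i) * pochhammer (b - real i) i))"

lemma nth_poly_times_geometric_power:
  assumes "degree Q \<le> d" "d \<le> r"
  shows "fps_nth (fps_of_poly Q * geometric_fps ^ Suc N) r =
         fact (N + r - d) / (fact N * fact r) * pochhammer_sum Q d (real (N + r - d) + 1) (real r + 1)"
proof -
  have "fps_nth (fps_of_poly Q * geometric_fps ^ Suc N) r =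
        (\<Sum>i\<le>r. coeff Q i * real ((N + (r - i)) choose (r - i)))"
    by (simp only: fps_mult_nth fps_of_poly_nth nth_geometric_power atLeast0AtMost)
  also have "\<dots> = (\<Sum>i\<le>d. coeff Q i * real ((N + (r - i)) choose (r - i)))"
    using assms by (intro sum.mono_neutral_right) (auto simp: coeff_eq_0)
  also have "\<dots> = (\<Sum>i\<le>d. fact (N + r - d) / (fact N * fact r) *
      (coeff Q i * (pochhammer (real (N + r - d) + 1) (d - i) * pochhammer (real r + 1 - real i) i)))"
  proof (intro sum.cong refl)
    fix i assume "i \<in> {..d}"
    then have i: "i \<le> d" "i \<le> r"
      using assms by auto
    have "fact (N + (r - i)) = fact (N + r - d) * pochhammer (real (N + r - d) + 1) (d - i)"
      using pochhammer_of_nat_fact [of "N + r - d" "d - i"] i assms by (simp add: algebra_simps)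
    moreover have "fact r = fact (r - i) * pochhammer (real r + 1 - real i) i"
      using pochhammer_of_nat_fact [of "r - i" i] i by (simp add: of_nat_diff algebra_simps)
    moreover have "real ((N + (r - i)) choose (r - i)) = fact (N + (r - i)) / (fact (r - i) * fact N)"
      by (subst binomial_fact) auto
    moreover have "fact r \<noteq> (0 :: real)"
      by simp
    ultimately show "coeff Q i * real ((N + (r - i)) choose (r - i)) = fact (N + r - d) / (fact N * fact r) *
      (coeff Q i * (pochhammer (real (N + r - d) + 1) (d - i) * pochhammer (real r + 1 - real i) i))"
      by (simp add: field_simps)
  qed
  finally show ?thesis
    by (simp add: pochhammer_sum_def sum_distrib_left)
qed

definition log_deriv_phi3_poly :: "real poly" where
  "log_deriv_phi3_poly = [:1, 9, -828, -18060, -112194, -112194, -18060, -828, 9, 1:]"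

lemma log_deriv_phi3: "log_deriv_fps * phi_fps ^ 3 = fps_of_poly log_deriv_phi3_poly"
proof -
  have "[:1, -33, -33, 1:] * gleason_phi ^ 3 = log_deriv_phi3_poly"
    by (simp add: log_deriv_phi3_poly_def gleason_phi_def power3_eq_cube)
  then show ?thesis
    by (simp only: log_deriv_fps_def phi_fps_def fps_of_poly_mult [symmetric] fps_of_poly_power [symmetric])
qed

text \<open>
  The relation for \<open>l = 1\<close>.  The cubic is treated as a polynomial of degree at most \<open>4\<close>, so that the
  common factor contains the same \<open>(5 k + 1)!\<close> as for the second coefficient.
\<close>

lemma first_coefficient:
  assumes "k \<ge> 3" and inv: "invariant_poly (3 * k + 2) P" and P0: "coeff P 0 = 1"
    and gap: "\<And>i. 1 \<le> i \<Longrightarrow> i \<le> k \<Longrightarrow> coeff P i = 0"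
  shows "coeff P (k + 1) = - (fact (5 * k + 1) / (fact (4 * k + 4) * fact (k + 1)) *
           pochhammer_sum [:1, -33, -33, 1:] 4 (5 * real k + 2) (real k + 2))"
proof -
  define Q where "Q = log_deriv_fps * geometric_fps ^ Suc (4 * k + 4)"
  have "Suc (4 * k + 4) = 4 * (k + 1) + 1"
    by simp
  then have "0 = fps_nth (fps_of_poly P * Q) (k + 1)"
    unfolding Q_def using invariant_poly_residue [OF inv, of 1] by (simp add: mult.assoc)
  also have "\<dots> = (\<Sum>i\<in>{0..k + 1}. coeff P i * fps_nth Q (k + 1 - i))"
    by (simp add: fps_mult_nth)
  also have "\<dots> = (\<Sum>i\<in>{0, k + 1}. coeff P i * fps_nth Q (k + 1 - i))"
    using gap by (intro sum.mono_neutral_right) (auto simp: Suc_le_eq)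
  also have "\<dots> = fps_nth Q (k + 1) + coeff P (k + 1) * fps_nth Q 0"
    using P0 by simp
  also have "fps_nth Q 0 = 1"
    by (simp add: Q_def log_deriv_fps_def geometric_fps_def fps_nth_power_0)
  also have "fps_nth Q (k + 1) = fact (5 * k + 1) / (fact (4 * k + 4) * fact (k + 1)) *
      pochhammer_sum [:1, -33, -33, 1:] 4 (5 * real k + 2) (real k + 2)"
  proof -
    have "4 * k + 4 + (k + 1) - 4 = 5 * k + 1"
      by simp
    then show ?thesis
      unfolding Q_def log_deriv_fps_def
      by (subst nth_poly_times_geometric_power [of _ 4]) (use assms(1) in \<open>simp_all add: add_ac\<close>)
  qed
  finally show ?thesis
    by simp
qed

text \<open>
  The relation for \<open>l = 2\<close>; \<open>4 k + 18\<close> is the linear coefficient of the series that multiplies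
  the enumerator.
\<close>

lemma second_coefficient:
  assumes "k \<ge> 7" and inv: "invariant_poly (3 * k + 2) P" and P0: "coeff P 0 = 1"
    and gap: "\<And>i. 1 \<le> i \<Longrightarrow> i \<le> k \<Longrightarrow> coeff P i = 0"
  shows "coeff P (k + 2) = - (real (4 * k + 18) * coeff P (k + 1)) -
           fact (5 * k + 1) / (fact (4 * k + 8) * fact (k + 2)) *
             pochhammer_sum log_deriv_phi3_poly 9 (5 * real k + 2) (real k + 3)"
proof -
  define Q where "Q = fps_of_poly log_deriv_phi3_poly * geometric_fps ^ Suc (4 * k + 8)"
  have "Suc (4 * k + 8) = 4 * (k + 2) + 1"
    by simp
  then have "0 = fps_nth (fps_of_poly P * Q) (k + 2)"
    unfolding Q_def log_deriv_phi3 [symmetric]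
    using invariant_poly_residue [OF inv, of 2] by (simp add: mult.assoc)
  also have "\<dots> = (\<Sum>i\<in>{0..k + 2}. coeff P i * fps_nth Q (k + 2 - i))"
    by (simp add: fps_mult_nth)
  also have "\<dots> = (\<Sum>i\<in>{0, k + 1, k + 2}. coeff P i * fps_nth Q (k + 2 - i))"
  proof (intro sum.mono_neutral_right ballI)
    fix i assume "i \<in> {0..k + 2} - {0, k + 1, k + 2}"
    then have "1 \<le> i" "i \<le> k"
      by auto
    then show "coeff P i * fps_nth Q (k + 2 - i) = 0"
      by (simp add: gap)
  qed auto
  also have "\<dots> = fps_nth Q (k + 2) + coeff P (k + 1) * fps_nth Q 1 + coeff P (k + 2) * fps_nth Q 0"
    using P0 by simp
  also have "fps_nth Q 0 = 1"
    by (simp add: Q_def log_deriv_phi3_poly_def geometric_fps_def fps_nth_power_0)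
  also have "fps_nth Q 1 = real (4 * k + 18)"
  proof -
    have "fps_nth Q 1 = coeff log_deriv_phi3_poly 0 * fps_nth (geometric_fps ^ Suc (4 * k + 8)) 1 +
        coeff log_deriv_phi3_poly 1 * fps_nth (geometric_fps ^ Suc (4 * k + 8)) 0"
      unfolding Q_def by (simp only: fps_mult_nth_1 fps_of_poly_nth)
    then show ?thesis
      unfolding nth_geometric_power by (simp add: log_deriv_phi3_poly_def)
  qed
  also have "fps_nth Q (k + 2) = fact (5 * k + 1) / (fact (4 * k + 8) * fact (k + 2)) *
      pochhammer_sum log_deriv_phi3_poly 9 (5 * real k + 2) (real k + 3)"
  proof -
    have "4 * k + 8 + (k + 2) - 9 = 5 * k + 1"
      by simp
    then show ?thesis
      unfolding Q_def
      by (subst nth_poly_times_geometric_power [of _ 9])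
         (use assms(1) in \<open>simp_all add: add_ac log_deriv_phi3_poly_def\<close>)
  qed
  finally show ?thesis
    by (simp add: algebra_simps)
qed

lemma cubic_pochhammer_sum:
  "pochhammer_sum [:1, -33, -33, 1:] 4 (5 * x + 2) (x + 2) =
   - (24 * (x + 1) * (3 * x + 2) * (5 * x + 2) * (12 * x + 7))"
  by (simp add: pochhammer_sum_def eval_nat_numeral pochhammer_Suc algebra_simps)

lemma log_deriv_phi3_pochhammer_sum:
  "pochhammer_sum log_deriv_phi3_poly 9 (5 * x + 2) (x + 3) =
   (x + 1) * (x + 2) * (3 * x + 2) * (12 * x + 7) *
     ((((((-21233664) * x - 55738368) * x - 62042112) * x - 38389248) * x - 13506048) * x - 2021760)"
  apply (simp add: pochhammer_sum_def log_deriv_phi3_poly_def numeral_eq_Suc atMost_Suc)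
  apply (simp add: pochhammer_Suc)
  apply (simp add: algebra_simps)
  done

text \<open>
  Three linear factors split off, which leaves a polynomial of degree \<open>7\<close> to be examined.  Here
  \<open>A\<close> and \<open>B\<close> stand for Pochhammer symbols and \<open>q\<close> for a quintic.
\<close>

lemma threshold_polynomial_factor:
  fixes A B q x :: real
  shows "(6 * x + 4) * (5 * x + 3) * (x + 1) * (A * (4 * (x + 2)))
     - (4 * x + 18) * ((x + 2) * B) * - (24 * (x + 1) * (3 * x + 2) * (5 * x + 2) * (12 * x + 7))
     + (x + 1) * (x + 2) * (3 * x + 2) * (12 * x + 7) * q
     = (3 * x + 2) * (x + 1) * (x + 2) *
       (8 * (5 * x + 3) * A + 24 * (4 * x + 18) * B * (5 * x + 2) * (12 * x + 7) + (12 * x + 7) * q)"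
  by (simp add: algebra_simps)

text \<open>
  The bound \<open>148\<close> comes from here: at \<open>147\<close> the polynomial is negative.
\<close>

lemma threshold_polynomial_pos:
  assumes "x \<ge> 148"
  shows "(6 * x + 4) * (5 * x + 3) * (x + 1) * pochhammer (4 * x + 2) 7
     - (4 * x + 18) * ((x + 2) * pochhammer (4 * x + 5) 4) * pochhammer_sum [:1, -33, -33, 1:] 4 (5 * x + 2) (x + 2)
     + pochhammer_sum log_deriv_phi3_poly 9 (5 * x + 2) (x + 3) > 0"
proof -
  (* The cofactor R has only positive Taylor coefficients at 148. *)
  define s where "s = x - 148"
  have s: "s \<ge> 0" "x = s + 148"
    using assms by (simp_all add: s_def)
  define R where "R = (((((((1638400) * x - 235929600) * x - 731254784) * x - 931000320) * x - 626969600) * x - 235791360) * x - 46964736) * x - 3870720"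
  have "R = (16499381285840302080) + (18244115092712423424) * s + (721375539320212480) * s ^ 2 + (12055383802393600) * s ^ 3 + (107838231531520) * s ^ 4 + (543401046016) * s ^ 5 + (1461452800) * s ^ 6 + (1638400) * s ^ 7"
    unfolding R_def s(2) by (simp add: algebra_simps eval_nat_numeral)
  also have "\<dots> > 0"
    using s(1) by (intro add_pos_nonneg mult_nonneg_nonneg zero_le_power) auto
  finally have "R > 0" .
  have R: "R = 8 * (5 * x + 3) * pochhammer (4 * x + 2) 6
      + 24 * (4 * x + 18) * pochhammer (4 * x + 5) 4 * (5 * x + 2) * (12 * x + 7)
      + (12 * x + 7) * ((((((-21233664) * x - 55738368) * x - 62042112) * x - 38389248) * x - 13506048) * x - 2021760)"
    unfolding R_def
    apply (simp add: numeral_eq_Suc pochhammer_Suc)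
    apply (simp add: algebra_simps)
    done
  have "pochhammer (4 * x + 2) 7 = pochhammer (4 * x + 2) 6 * (4 * (x + 2))"
    using pochhammer_Suc [of "4 * x + 2" 6] by (simp add: algebra_simps)
  then have "(6 * x + 4) * (5 * x + 3) * (x + 1) * pochhammer (4 * x + 2) 7
     - (4 * x + 18) * ((x + 2) * pochhammer (4 * x + 5) 4) * pochhammer_sum [:1, -33, -33, 1:] 4 (5 * x + 2) (x + 2)
     + pochhammer_sum log_deriv_phi3_poly 9 (5 * x + 2) (x + 3)
     = (3 * x + 2) * (x + 1) * (x + 2) * R"
    unfolding cubic_pochhammer_sum log_deriv_phi3_pochhammer_sum R by (simp only: threshold_polynomial_factor)
  with \<open>R > 0\<close> assms show ?thesis
    by simp
qed

text \<open>
  The right-hand side is the value of the signed count at \<open>k + 2\<close>.  After division by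
  \<open>(5 k + 1)! / ((4 k + 8)! (k + 2)!)\<close> the claim is the positivity of the threshold polynomial.
\<close>

theorem second_coefficient_less:
  assumes k: "k \<ge> 148" and inv: "invariant_poly (3 * k + 2) P" and P0: "coeff P 0 = 1"
    and gap: "\<And>i. 1 \<le> i \<Longrightarrow> i \<le> k \<Longrightarrow> coeff P i = 0"
  shows "coeff P (k + 2) <
    real (6 * k + 4) * fact (5 * k + 3) / (fact k * real (k + 2) * fact (4 * k + 1) * real (5 * k + 2))"
proof -
  define x where "x = real k"
  define S T where "S = pochhammer_sum [:1, -33, -33, 1:] 4 (5 * x + 2) (x + 2)"
    and "T = pochhammer_sum log_deriv_phi3_poly 9 (5 * x + 2) (x + 3)"
  define u v w :: real where "u = fact (5 * k + 1)" and "v = fact (4 * k + 8)" and "w = fact (k + 2)"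
  have pos: "u > 0" "v > 0" "w > 0" "x \<ge> 0"
    by (simp_all add: u_def v_def w_def x_def)
  have v4: "v = fact (4 * k + 4) * pochhammer (4 * x + 5) 4"
    using pochhammer_of_nat_fact [of "4 * k + 4" 4] by (simp add: v_def x_def add_ac)
  have v1: "v = fact (4 * k + 1) * pochhammer (4 * x + 2) 7"
    using pochhammer_of_nat_fact [of "4 * k + 1" 7] by (simp add: v_def x_def add_ac)
  have w: "w = fact (k + 1) * (x + 2)" "w = fact k * (x + 1) * (x + 2)"
    by (simp_all add: w_def x_def algebra_simps)
  have "fact (5 * k + 3) = u * (5 * x + 2) * (5 * x + 3)"
    using pochhammer_of_nat_fact [of "5 * k + 1" 2]
    by (simp add: u_def x_def eval_nat_numeral pochhammer_Suc algebra_simps)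
  then have D: "real (6 * k + 4) * fact (5 * k + 3) / (fact k * real (k + 2) * fact (4 * k + 1) * real (5 * k + 2)) =
      u / (v * w) * ((6 * x + 4) * (5 * x + 3) * (x + 1) * pochhammer (4 * x + 2) 7)"
    using pos pochhammer_pos [of "4 * x + 2" 7] by (simp add: v1 w(2) x_def add_ac divide_simps)
  have first: "coeff P (k + 1) = - (u / (v * w) * ((x + 2) * pochhammer (4 * x + 5) 4 * S))"
    using first_coefficient [OF _ inv P0 gap] k pos pochhammer_pos [of "4 * x + 5" 4]
    by (simp add: v4 w(1) x_def S_def u_def add_ac divide_simps)
  have "coeff P (k + 2) = - ((4 * x + 18) * coeff P (k + 1)) - u / (v * w) * T"
    using second_coefficient [OF _ inv P0 gap] k by (simp add: x_def T_def u_def v_def w_def)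
  also have "\<dots> = u / (v * w) * ((4 * x + 18) * ((x + 2) * pochhammer (4 * x + 5) 4) * S - T)"
    unfolding first by (simp only: mult_minus_right minus_minus right_diff_distrib mult_ac)
  also have "\<dots> < u / (v * w) * ((6 * x + 4) * (5 * x + 3) * (x + 1) * pochhammer (4 * x + 2) 7)"
    using threshold_polynomial_pos [of x] k pos
    by (intro mult_strict_left_mono) (simp_all add: S_def T_def x_def)
  finally show ?thesis
    by (simp only: D)
qed

section \<open>Signed enumerators of doubly even self-dual codes\<close>

lemma linear_dual_code: "linear_code (dual_code E)"
  by (auto simp only: linear_code_def dual_code_def mem_Collect_eq scalar_product_zero
        scalar_product_add_left add_0 ball_simps)

lemma self_dual_linear: "self_dual C \<Longrightarrow> linear_code C"
  using linear_dual_code unfolding self_dual_def by metis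

lemma self_dual_orthogonal: "self_dual C \<Longrightarrow> x \<in> C \<Longrightarrow> y \<in> C \<Longrightarrow> scalar_product x y = 0"
  unfolding self_dual_def dual_code_def by blast

lemma self_dual_memI: "self_dual C \<Longrightarrow> (\<And>y. y \<in> C \<Longrightarrow> scalar_product x y = 0) \<Longrightarrow> x \<in> C"
  unfolding self_dual_def dual_code_def by blast

lemma card_self_dual:
  fixes C :: "(bit ^ 'n) set"
  assumes "self_dual C" "CARD('n) = 8 * m"
  shows "card C = 16 ^ m"
proof -
  have "(card C)\<^sup>2 = 2 ^ (8 * m)"
    using card_dual_code [OF self_dual_linear [OF assms(1)]] assms
    by (simp add: self_dual_def power2_eq_square)
  also have "\<dots> = (16 ^ m)\<^sup>2"
    by (simp add: power_mult flip: power_mult_distrib power2_eq_square)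
       (simp add: power2_eq_square flip: power_mult_distrib)
  finally show ?thesis
    by (simp add: power2_eq_iff_nonneg)
qed

text \<open>
  Codewords are counted with the sign given by \<open>v\<close>, in the variable \<open>x = y\<^sup>4\<close>; for \<open>v = 0\<close> this is
  the weight enumerator.
\<close>

definition signed_enumerator :: "bit ^ 'n \<Rightarrow> (bit ^ 'n) set \<Rightarrow> real poly" where
  "signed_enumerator v D = (\<Sum>e\<in>D. monom (character v e) (weight e div 4))"

lemma coeff_signed_enumerator:
  "coeff (signed_enumerator v D) j = (\<Sum>e | e \<in> D \<and> weight e div 4 = j. character v e)"
  by (simp add: signed_enumerator_def coeff_sum sum.If_cases Int_def)

lemma character_le_1: "character v x \<le> (1 :: real)"
  by (simp add: character_def bit_sign_def)

lemma coeff_signed_enumerator_le: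
  "coeff (signed_enumerator v D) j \<le> coeff (signed_enumerator 0 D) j"
  unfolding coeff_signed_enumerator by (intro sum_mono) (simp add: character_le_1)

lemma degree_signed_enumerator_le:
  fixes D :: "(bit ^ 'n) set"
  assumes "CARD('n) = 8 * m"
  shows "degree (signed_enumerator v D) \<le> 2 * m"
  unfolding signed_enumerator_def
proof (rule degree_sum_le)
  fix e :: "bit ^ 'n"
  have "weight e div 4 \<le> 2 * m"
    using weight_le [of e] assms by simp
  then show "degree (monom (character v e :: real) (weight e div 4)) \<le> 2 * m"
    using degree_monom_le order_trans by blast
qed auto

locale doubly_even_code =
  fixes D :: "(bit ^ 'n) set" and m :: nat
  assumes length: "CARD('n) = 8 * m"
    and self_dual: "self_dual D"
    and doubly_even: "x \<in> D \<Longrightarrow> weight x mod 4 = 0"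
begin

lemma poly_signed_enumerator:
  "poly (signed_enumerator v D) (y ^ 4) = (\<Sum>e\<in>D. character v e * y ^ weight e)"
  unfolding signed_enumerator_def poly_sum
proof (intro sum.cong refl)
  fix e assume "e \<in> D"
  then have "4 * (weight e div 4) = weight e"
    using doubly_even [of e] by auto
  then show "poly (monom (character v e) (weight e div 4)) (y ^ 4) = character v e * y ^ weight e"
    by (simp add: poly_monom flip: power_mult)
qed

text \<open>
  The MacWilliams identity at \<open>t = (1 - y) / (1 + y)\<close>, a substitution that moves the binomial
  factors from the code to the coset.
\<close>

lemma signed_enumerator_macwilliams:
  assumes y: "1 + y \<noteq> 0"
  shows "16 ^ m * poly (signed_enumerator v D) (y ^ 4) =
         (\<Sum>z | v + z \<in> D. (1 + y) ^ (8 * m - weight z) * (1 - y) ^ weight z)"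
proof -
  define t where "t = cayley y"
  have t: "(1 + y) * (1 + t) = 2" "(1 + y) * (1 - t) = 2 * y" "(1 + y) * t = 1 - y"
    using y by (simp_all add: t_def cayley_def field_simps)
  have split: "(1 + y) ^ (8 * m) = (1 + y) ^ (8 * m - weight e) * (1 + y) ^ weight e" for e :: "bit ^ 'n"
    using weight_le [of e] length by (simp flip: power_add)
  have "16 ^ m * (16 ^ m * poly (signed_enumerator v D) (y ^ 4)) =
        (\<Sum>e\<in>D. character v e * (2 ^ (8 * m) * y ^ weight e))"
  proof -
    have "16 ^ m * 16 ^ m = (2 :: real) ^ (8 * m)"
      by (simp add: power_mult flip: power_mult_distrib)
    then show ?thesis
      by (simp add: poly_signed_enumerator sum_distrib_left mult_ac)
  qed
  also have "\<dots> = (\<Sum>e\<in>D. (1 + y) ^ (8 * m) * (character v e * (1 + t) ^ (8 * m - weight e) * (1 - t) ^ weight e))"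
  proof (intro sum.cong refl)
    fix e :: "bit ^ 'n"
    have "(1 + y) ^ (8 * m) * (character v e * (1 + t) ^ (8 * m - weight e) * (1 - t) ^ weight e) =
          character v e * (((1 + y) * (1 + t)) ^ (8 * m - weight e) * ((1 + y) * (1 - t)) ^ weight e)"
      unfolding split [of e] by (simp only: power_mult_distrib mult_ac)
    also have "\<dots> = character v e * ((2 ^ (8 * m - weight e) * 2 ^ weight e) * y ^ weight e)"
      unfolding t by (simp only: power_mult_distrib mult_ac)
    also have "2 ^ (8 * m - weight e) * 2 ^ weight e = (2 :: real) ^ (8 * m)"
      using weight_le [of e] length by (simp flip: power_add)
    finally show "character v e * (2 ^ (8 * m) * y ^ weight e) =
        (1 + y) ^ (8 * m) * (character v e * (1 + t) ^ (8 * m - weight e) * (1 - t) ^ weight e)" ..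
  qed
  also have "\<dots> = (1 + y) ^ (8 * m) * (16 ^ m * (\<Sum>z | v + z \<in> D. t ^ weight z))"
  proof -
    have "dual_code D = D"
      using self_dual by (simp add: self_dual_def)
    then show ?thesis
      using macwilliams [OF self_dual_linear [OF self_dual], of v t] length
        card_self_dual [OF self_dual length]
      by (simp add: sum_distrib_left [symmetric])
  qed
  also have "\<dots> = 16 ^ m * (\<Sum>z | v + z \<in> D. (1 + y) ^ (8 * m - weight z) * (1 - y) ^ weight z)"
  proof -
    have "(1 + y) ^ (8 * m) * t ^ weight z = (1 + y) ^ (8 * m - weight z) * (1 - y) ^ weight z"
      for z :: "bit ^ 'n"
      unfolding split [of z] t(3) [symmetric] by (simp only: power_mult_distrib mult_ac)
    then show ?thesis
      by (simp only: mult.left_commute [of _ "16 ^ m"] sum_distrib_left [of "(1 + y) ^ (8 * m)"])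
  qed
  finally show ?thesis
    by simp
qed

lemma invariant_weight_enumerator: "invariant_poly m (signed_enumerator 0 D)"
proof -
  have "16 ^ m * poly (signed_enumerator 0 D) (y ^ 4) =
        (1 + y) ^ (8 * m) * poly (signed_enumerator 0 D) (cayley y ^ 4)"
    if "y \<in> punctured_line" for y
  proof -
    have y: "1 + y \<noteq> 0"
      using that by (auto simp: punctured_line_def)
    have "(1 + y) ^ (8 * m - weight z) * (1 - y) ^ weight z = (1 + y) ^ (8 * m) * cayley y ^ weight z"
      for z :: "bit ^ 'n"
    proof -
      have "(1 + y) ^ (8 * m) = (1 + y) ^ (8 * m - weight z) * (1 + y) ^ weight z"
        using weight_le [of z] length by (simp flip: power_add)
      then show ?thesis
        using y by (simp add: cayley_def power_divide)
    qed
    then have "16 ^ m * poly (signed_enumerator 0 D) (y ^ 4) =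
        (\<Sum>z\<in>D. (1 + y) ^ (8 * m) * cayley y ^ weight z)"
      using signed_enumerator_macwilliams [OF y, of 0] by simp
    then show ?thesis
      by (simp add: poly_signed_enumerator [of _ "cayley y"] sum_distrib_left)
  qed
  then show ?thesis
    by (simp add: invariant_poly_def degree_signed_enumerator_le [OF length])
qed

text \<open>
  Every vector of the coset contributes a multiple of \<open>(1 - y) ^ r\<close>.
\<close>

lemma power_dvd_signed_enumerator:
  assumes far: "\<And>z. v + z \<in> D \<Longrightarrow> r \<le> weight z"
  shows "[:1, -1:] ^ r dvd signed_enumerator v D"
proof (rule power_dvd_if_fourth_powers)
  fix y assume "y \<in> punctured_line"
  then have y: "1 + y \<noteq> 0"
    by (auto simp: punctured_line_def)
  have "(1 - y) ^ weight z = (1 - y) ^ r * (1 - y) ^ (weight z - r)" if "v + z \<in> D" for z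
    using far [OF that] by (simp flip: power_add)
  then have "16 ^ m * poly (signed_enumerator v D) (y ^ 4) =
      (\<Sum>z | v + z \<in> D. (1 + y) ^ (8 * m - weight z) * ((1 - y) ^ r * (1 - y) ^ (weight z - r)))"
    unfolding signed_enumerator_macwilliams [OF y] by (intro sum.cong) auto
  also have "\<dots> = (1 - y) ^ r * poly (\<Sum>z | v + z \<in> D. [:1, 1:] ^ (8 * m - weight z) * [:1, -1:] ^ (weight z - r)) y"
    by (simp add: poly_sum poly_power sum_distrib_left mult_ac)
  finally show "poly (signed_enumerator v D) (y ^ 4) = (1 - y) ^ r * poly (smult (1 / 16 ^ m)
      (\<Sum>z | v + z \<in> D. [:1, 1:] ^ (8 * m - weight z) * [:1, -1:] ^ (weight z - r))) y"
    by (simp add: field_simps)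
qed

end

text \<open>
  The operator \<open>x d/dx - c\<close> multiplies the coefficient of \<open>x ^ j\<close> by \<open>j - c\<close> and lowers the order
  of vanishing at \<open>1\<close> by at most one, so after applying it for every \<open>c\<close> in \<open>C\<close> the polynomial still
  vanishes at \<open>1\<close>.
\<close>

lemma sum_coeff_prod_eq_0:
  fixes q :: "real poly" and C :: "nat set"
  assumes "finite C" "[:1, -1:] ^ (card C + 1) dvd q" "degree q \<le> N"
  shows "(\<Sum>j\<le>N. coeff q j * (\<Prod>c\<in>C. real j - real c)) = 0"
  using assms
proof (induction C arbitrary: q rule: finite_induct)
  case empty
  then have "poly q 1 = 0"
    by (auto elim: dvdE)
  then show ?case
    using poly_eq_sum_coeff [OF empty.prems(2), of 1] by simp
next
  case (insert c C)
  define q' where "q' = pCons 0 (pderiv q) - smult (real c) q"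
  have coeff: "coeff q' j = (real j - real c) * coeff q j" for j
    by (simp add: q'_def coeff_pCons coeff_pderiv algebra_simps split: nat.split)
  have "card (insert c C) + 1 = Suc (card C + 1)"
    using insert.hyps by simp
  then obtain w where w: "q = [:1, -1:] ^ Suc (card C + 1) * w"
    using insert.prems(1) unfolding dvd_def by metis
  have "[:1, -1:] ^ (card C + 1) dvd pderiv q"
    unfolding w pderiv_mult pderiv_power_Suc
  proof (rule dvd_add)
    show "[:1, -1:] ^ (card C + 1) dvd [:1, -1:] ^ Suc (card C + 1) * pderiv w"
      by (rule dvd_mult2, rule le_imp_power_dvd) simp
    show "[:1, -1:] ^ (card C + 1) dvd
        w * (smult (of_nat (Suc (card C + 1))) ([:1, -1:] ^ (card C + 1)) * pderiv [:1, -1:])"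
      by (rule dvd_mult, rule dvd_mult2, rule dvd_smult, rule dvd_refl)
  qed
  moreover have "[:1, -1:] ^ (card C + 1) dvd q"
    unfolding w by (rule dvd_mult2, rule le_imp_power_dvd) simp
  moreover have "pCons 0 (pderiv q) = [:0, 1:] * pderiv q"
    by simp
  ultimately have "[:1, -1:] ^ (card C + 1) dvd q'"
    unfolding q'_def by (metis dvd_diff dvd_mult dvd_smult)
  moreover have "degree q' \<le> N"
    using insert.prems(2) by (intro degree_le) (auto simp: coeff coeff_eq_0)
  ultimately have "(\<Sum>j\<le>N. coeff q' j * (\<Prod>c\<in>C. real j - real c)) = 0"
    by (rule insert.IH)
  then show ?case
    using insert.hyps by (simp add: coeff mult_ac)
qed

lemma prod_uminus_interval: "(\<Prod>c\<in>{a + 1..a + N}. - real c) = (-1) ^ N * fact (a + N) / fact a"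
  by (induction N) (simp_all add: algebra_simps)

lemma prod_diff_interval: "(\<Prod>c\<in>{a + 1..a + N}. real a - real c) = (-1) ^ N * fact N"
  by (induction N) (simp_all add: algebra_simps)

text \<open>
  The indices where \<open>q\<close> may be non-zero are \<open>0\<close>, \<open>k + 1\<close> to \<open>5 k + 3\<close>, and \<open>6 k + 4\<close>, one more than
  the order of vanishing guaranteed at \<open>1\<close>.  A product of linear factors that excludes all of them but two
  relates the coefficients at these two.
\<close>

lemma signed_coefficient:
  fixes q :: "real poly"
  assumes dvd: "[:1, -1:] ^ (4 * k + 4) dvd q" and deg: "degree q \<le> 6 * k + 4" and q0: "coeff q 0 = 1"
    and gap: "\<And>j. 1 \<le> j \<Longrightarrow> j \<le> k \<Longrightarrow> coeff q j = 0"
      "\<And>j. 5 * k + 4 \<le> j \<Longrightarrow> j < 6 * k + 4 \<Longrightarrow> coeff q j = 0"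
  shows "coeff q (k + 2) =
    real (6 * k + 4) * fact (5 * k + 3) / (fact k * real (k + 2) * fact (4 * k + 1) * real (5 * k + 2))"
proof -
  define I C where "I = {k + 2 + 1..k + 2 + (4 * k + 1)}" and "C = insert (k + 1) (insert (6 * k + 4) I)"
  define p where "p j = (\<Prod>c\<in>C. real j - real c)" for j
  have fin: "finite C" and card: "card C + 1 = 4 * k + 4"
    by (simp_all add: C_def I_def)
  have p: "p j = (real j - real (k + 1)) * ((real j - real (6 * k + 4)) * (\<Prod>c\<in>I. real j - real c))" for j
    by (simp add: p_def C_def I_def)
  have "0 = (\<Sum>j\<le>6 * k + 4. coeff q j * p j)"
    unfolding p_def by (rule sum_coeff_prod_eq_0 [OF fin dvd [folded card] deg, symmetric])
  also have "\<dots> = (\<Sum>j\<in>{0, k + 2}. coeff q j * p j)"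
  proof (intro sum.mono_neutral_right ballI)
    fix j assume j: "j \<in> {..6 * k + 4} - {0, k + 2}"
    then consider "1 \<le> j" "j \<le> k" | "j \<in> C" | "5 * k + 4 \<le> j" "j < 6 * k + 4"
      by (auto simp: C_def I_def; linarith)
    then show "coeff q j * p j = 0"
      by cases (use gap fin in \<open>auto simp: p_def\<close>)
  qed auto
  also have "\<dots> = p 0 + coeff q (k + 2) * p (k + 2)"
    by (simp add: q0)
  also have "p 0 = - (real (k + 1) * real (6 * k + 4) * fact (5 * k + 3) / fact (k + 2))"
  proof -
    have "k + 2 + (4 * k + 1) = 5 * k + 3"
      by simp
    then have "(\<Prod>c\<in>I. - real c) = - (fact (5 * k + 3) / fact (k + 2))"
      unfolding I_def prod_uminus_interval by (simp only:) simp
    then show ?thesis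
      unfolding p by (simp only: of_nat_0 diff_0 mult_minus_left mult_minus_right minus_minus mult.assoc times_divide_eq_right)
  qed
  also have "p (k + 2) = real (5 * k + 2) * fact (4 * k + 1)"
    unfolding p I_def prod_diff_interval by (simp add: algebra_simps)
  finally have eq: "0 = - (real (k + 1) * real (6 * k + 4) * fact (5 * k + 3) / fact (k + 2)) +
      coeff q (k + 2) * (real (5 * k + 2) * fact (4 * k + 1))" .
  have fact_eq: "fact (k + 2) = real (k + 2) * (real (k + 1) * fact k)"
    by (simp add: algebra_simps)
  have solve: "c = b * F / (f * h * G * d)"
    if "0 = - (a * b * F / (h * (a * f))) + c * (d * G)" "a \<noteq> 0" "h \<noteq> 0" "f \<noteq> 0" "G \<noteq> 0" "d \<noteq> 0"
    for a b c d f h F G :: real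
    using that by (simp add: field_simps)
  show ?thesis
    by (rule solve [OF eq [unfolded fact_eq]]) simp_all
qed

section \<open>Non-existence of distant cosets\<close>

lemma weight_add:
  "weight (x + y) + 2 * card {i. x $ i \<noteq> 0 \<and> y $ i \<noteq> 0} = weight x + weight (y :: bit ^ 'n)"
proof -
  define A B where "A = {i. x $ i \<noteq> 0}" and "B = {i. y $ i \<noteq> 0}"
  have "weight (x + y) = card ((A - B) \<union> (B - A))"
    unfolding weight_def A_def B_def by (rule arg_cong [of _ _ card]) auto
  also have "\<dots> = card (A - B) + card (B - A)"
    by (rule card_Un_disjoint) auto
  finally have "weight (x + y) + 2 * card (A \<inter> B) = (card (A - B) + card (A \<inter> B)) + (card (B - A) + card (A \<inter> B))"
    by simp
  also have "card (A - B) + card (A \<inter> B) = card A"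
    by (simp add: card_Diff_subset_Int card_mono)
  also have "card (B - A) + card (A \<inter> B) = card B"
    by (simp add: card_Diff_subset_Int card_mono Int_commute)
  finally show ?thesis
    by (simp add: weight_def A_def B_def Int_def)
qed

lemma scalar_product_eq_0_iff:
  "scalar_product x y = 0 \<longleftrightarrow> even (card {i. x $ i \<noteq> 0 \<and> y $ i \<noteq> (0 :: bit)})"
proof -
  have "scalar_product x y = (\<Sum>i\<in>UNIV. of_bool (x $ i \<noteq> 0 \<and> y $ i \<noteq> 0))"
    unfolding scalar_product_def by (intro sum.cong) auto
  also have "\<dots> = of_nat (card {i. x $ i \<noteq> 0 \<and> y $ i \<noteq> 0})"
    by simp
  finally have "scalar_product x y = of_nat (card {i. x $ i \<noteq> 0 \<and> y $ i \<noteq> 0})" .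
  moreover have "(of_nat n :: bit) = 0 \<longleftrightarrow> even n" for n
    by (induction n) auto
  ultimately show ?thesis
    by (simp only:)
qed

lemma scalar_product_self_eq_0_iff: "scalar_product x x = 0 \<longleftrightarrow> even (weight (x :: bit ^ 'n))"
  by (simp only: scalar_product_eq_0_iff weight_def simp_thms)

lemma scalar_product_one: "scalar_product x 1 = scalar_product x (x :: bit ^ 'n)"
  unfolding scalar_product_def by (intro sum.cong) auto

lemma weight_one_add: "weight (1 + x) = CARD('n) - weight (x :: bit ^ 'n)"
proof -
  have eq: "{i. (1 + x) $ i \<noteq> 0} = UNIV - {i. x $ i \<noteq> 0}"
    by auto
  show ?thesis
    unfolding weight_def eq by (rule card_Diff_subset) auto
qed

text \<open>
  All weights are even, so the all-one vector \<open>1\<close> is orthogonal to the code.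
\<close>

lemma one_in_self_dual: "self_dual C \<Longrightarrow> 1 \<in> C"
  by (rule self_dual_memI) (auto simp only: scalar_product_one self_dual_orthogonal scalar_product_commute [of 1])

text \<open>
  The signed and the unsigned count at weight \<open>4 k + 8\<close> are both determined, and the signed one is
  larger.
\<close>

theorem (in doubly_even_code) no_distant_coset:
  assumes k: "k \<ge> 148" and m: "m = 3 * k + 2"
    and min: "\<And>x. x \<in> D \<Longrightarrow> x \<noteq> 0 \<Longrightarrow> 4 * k + 4 \<le> weight x"
    and far: "\<And>z. v + z \<in> D \<Longrightarrow> 4 * k + 4 \<le> weight z"
  shows False
proof -
  have linear: "0 \<in> D" "\<And>x y. x \<in> D \<Longrightarrow> y \<in> D \<Longrightarrow> x + y \<in> D"
    using self_dual_linear [OF self_dual] by (auto simp: linear_code_def)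
  have const_coeff: "coeff (signed_enumerator u D) 0 = 1" for u
  proof -
    have "{e \<in> D. weight e div 4 = 0} = {0}"
      using linear(1) min by fastforce
    then show ?thesis
      by (simp add: coeff_signed_enumerator)
  qed
  have low: "coeff (signed_enumerator u D) j = 0" if "1 \<le> j" "j \<le> k" for u j
  proof -
    have empty: "{e \<in> D. weight e div 4 = j} = {}"
    proof (intro equals0I)
      fix e assume "e \<in> {e \<in> D. weight e div 4 = j}"
      then show False
        using that min [of e] by (cases "e = 0") auto
    qed
    show ?thesis
      unfolding coeff_signed_enumerator empty by simp
  qed
  (* Complementation excludes the weights from 20 k + 16 up to, but not including, the length. *)
  have high: "coeff (signed_enumerator u D) j = 0" if "5 * k + 4 \<le> j" "j < 6 * k + 4" for u j
  proof -
    have empty: "{e \<in> D. weight e div 4 = j} = {}"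
    proof (intro equals0I)
      fix e assume "e \<in> {e \<in> D. weight e div 4 = j}"
      then have e: "e \<in> D" "weight e = 4 * j"
        using doubly_even [of e] by auto
      then have w: "weight (1 + e) = 24 * k + 16 - 4 * j" and "1 + e \<in> D"
        using weight_one_add [of e] length linear(2) [OF one_in_self_dual [OF self_dual]] by (simp_all add: m)
      with that have "weight (1 + e) < 4 * k + 4" "weight (1 + e) \<noteq> 0"
        by simp_all
      then show False
        using min [OF \<open>1 + e \<in> D\<close>] by auto
    qed
    show ?thesis
      unfolding coeff_signed_enumerator empty by simp
  qed
  define \<kappa> where "\<kappa> = real (6 * k + 4) * fact (5 * k + 3) /
    (fact k * real (k + 2) * fact (4 * k + 1) * real (5 * k + 2))"
  have "degree (signed_enumerator v D) \<le> 6 * k + 4"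
    using degree_signed_enumerator_le [OF length, of v D] by (simp add: m)
  then have "coeff (signed_enumerator v D) (k + 2) = \<kappa>"
    unfolding \<kappa>_def using power_dvd_signed_enumerator [of v "4 * k + 4"] far const_coeff low high
    by (intro signed_coefficient) auto
  moreover have "coeff (signed_enumerator 0 D) (k + 2) < \<kappa>"
    unfolding \<kappa>_def using invariant_weight_enumerator const_coeff low k
    by (intro second_coefficient_less) (auto simp: m)
  ultimately show False
    using coeff_signed_enumerator_le [of v D "k + 2"] by simp
qed

section \<open>Minimum weight and covering radius\<close>

lemma min_weight_le: "x \<in> S \<Longrightarrow> x \<noteq> 0 \<Longrightarrow> min_weight S \<le> weight x"
  unfolding min_weight_def by (rule Min_le) auto

lemma hamming_dist_eq_weight: "hamming_dist x y = weight (x + y)"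
  unfolding hamming_dist_def weight_def by (rule arg_cong [of _ _ card]) auto

lemma far_vector_if_covering_radius:
  assumes "covering_radius C = Suc r"
  obtains v where "\<And>c. c \<in> C \<Longrightarrow> r < weight (c + v)"
proof -
  have "(\<Union>c\<in>C. hamming_sphere c r) \<noteq> UNIV"
    using not_less_Least [of r "\<lambda>R. (\<Union>c\<in>C. hamming_sphere c R) = UNIV"] assms
    by (auto simp: covering_radius_def)
  then obtain v where v: "v \<notin> (\<Union>c\<in>C. hamming_sphere c r)"
    by blast
  show thesis
  proof (rule that [of v])
    show "r < weight (c + v)" if "c \<in> C" for c
      using v that by (auto simp: hamming_sphere_def hamming_dist_eq_weight not_le)
  qed
qed

section \<open>Shadows of singly even self-dual codes\<close>

lemma power_mod_4:
  fixes z :: "'a :: monoid_mult"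
  assumes "z ^ 4 = 1"
  shows "z ^ w = z ^ (w mod 4)"
proof -
  have "z ^ w = z ^ (4 * (w div 4) + w mod 4)"
    by simp
  also have "\<dots> = (z ^ 4) ^ (w div 4) * z ^ (w mod 4)"
    by (simp only: power_add power_mult)
  finally show ?thesis
    by (simp add: assms)
qed

lemma i_power_4: "\<i> ^ 4 = 1" "(- \<i>) ^ 4 = 1"
  by (simp_all add: eval_nat_numeral)

lemma mod_4_eq_0_if_i_power_eq_1:
  assumes "\<i> ^ w = 1"
  shows "w mod 4 = 0"
proof -
  have "w mod 4 = 0 \<or> w mod 4 = 1 \<or> w mod 4 = 2 \<or> w mod 4 = 3"
    by presburger
  moreover have "\<i> ^ (w mod 4) = 1"
    using assms power_mod_4 [OF i_power_4(1), of w] by simp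
  ultimately show ?thesis
    by (elim disjE) (simp_all add: power3_eq_cube complex_eq_iff)
qed

locale singly_even_code =
  fixes C :: "(bit ^ 'n) set" and m :: nat
  assumes length: "CARD('n) = 8 * m"
    and self_dual: "self_dual C"
    and singly_even: "\<exists>x\<in>C. weight x mod 4 = 2"
begin

abbreviation C0 :: "(bit ^ 'n) set" where
  "C0 \<equiv> doubly_even_subcode C"

lemma zero_mem: "0 \<in> C" and add_mem: "x \<in> C \<Longrightarrow> y \<in> C \<Longrightarrow> x + y \<in> C"
  using self_dual_linear [OF self_dual] by (auto simp: linear_code_def)

lemma weight_even: "x \<in> C \<Longrightarrow> even (weight x)"
  using self_dual_orthogonal [OF self_dual] by (simp only: scalar_product_self_eq_0_iff [symmetric])

lemma weight_add_mod_4: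
  assumes "x \<in> C" "y \<in> C"
  shows "weight (x + y) mod 4 = (weight x + weight y) mod 4"
proof -
  have "even (card {i. x $ i \<noteq> 0 \<and> y $ i \<noteq> 0})"
    using self_dual_orthogonal [OF self_dual assms] by (simp only: scalar_product_eq_0_iff)
  then obtain q where "card {i. x $ i \<noteq> 0 \<and> y $ i \<noteq> 0} = 2 * q"
    by (elim evenE)
  then have "weight x + weight y = weight (x + y) + 4 * q"
    using weight_add [of x y] by simp
  then show ?thesis
    by simp
qed

lemma C0_iff: "x \<in> C0 \<longleftrightarrow> x \<in> C \<and> weight x mod 4 = 0"
  by (simp add: doubly_even_subcode_def)

lemma weight_mod_4_outside_C0: "x \<in> C \<Longrightarrow> x \<notin> C0 \<Longrightarrow> weight x mod 4 = 2"
proof -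
  assume "x \<in> C" "x \<notin> C0"
  then have "even (weight x)" "weight x mod 4 \<noteq> 0"
    using weight_even [of x] by (simp_all add: C0_iff)
  then show ?thesis
    by presburger
qed

lemma add_in_C0_iff:
  assumes "x \<in> C" "y \<in> C"
  shows "x + y \<in> C0 \<longleftrightarrow> (x \<in> C0 \<longleftrightarrow> y \<in> C0)"
proof -
  have mod: "weight z mod 4 = (if z \<in> C0 then 0 else 2)" if "z \<in> C" for z
    using that weight_mod_4_outside_C0 [of z] by (simp add: C0_iff)
  have "weight (x + y) mod 4 = (weight x mod 4 + weight y mod 4) mod 4"
    using weight_add_mod_4 [OF assms] by (simp add: mod_simps)
  then show ?thesis
    unfolding mod [OF assms(1)] mod [OF assms(2)] mod [OF add_mem [OF assms]]
    by (cases "x \<in> C0"; cases "y \<in> C0"; cases "x + y \<in> C0") simp_all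
qed

lemma linear_C0: "linear_code C0"
  using zero_mem add_in_C0_iff by (auto simp: linear_code_def C0_iff)

lemma C_subset_dual_C0: "C \<subseteq> dual_code C0"
  using self_dual_orthogonal [OF self_dual] by (auto simp: dual_code_def C0_iff)

text \<open>
  Counting: \<open>C0\<close> is a proper subset of \<open>C\<close>, so its dual code has more elements than the dual code of
  \<open>C\<close>, which is \<open>C\<close>.
\<close>

lemma shadow_nonempty: "shadow C \<noteq> {}"
proof
  assume "shadow C = {}"
  then have "dual_code C0 = C"
    using C_subset_dual_C0 by (auto simp: shadow_def)
  then have "card C0 * card C = card C * card C"
    using card_dual_code [OF linear_C0] card_dual_code [OF self_dual_linear [OF self_dual]] self_dual
    by (simp add: self_dual_def)
  moreover have "card C \<noteq> 0"
    using zero_mem by (auto simp: card_eq_0_iff)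
  ultimately have "card C0 = card C"
    by simp
  moreover have "C0 \<subset> C"
  proof -
    obtain x where "x \<in> C" "weight x mod 4 = 2"
      using singly_even by blast
    then have "x \<in> C" "x \<notin> C0"
      by (simp_all add: C0_iff)
    moreover have "C0 \<subseteq> C"
      by (auto simp: C0_iff)
    ultimately show ?thesis
      by blast
  qed
  ultimately show False
    using psubset_card_mono [of C C0] by simp
qed

text \<open>
  A shadow vector is orthogonal to \<open>C0\<close>.  If it were orthogonal to one more element of \<open>C\<close>, it would
  be orthogonal to all of \<open>C\<close>, as \<open>C0\<close> has only two cosets in \<open>C\<close>.
\<close>

lemma shadow_orthogonal_iff:
  assumes s: "s \<in> shadow C" and x: "x \<in> C"
  shows "scalar_product s x = 0 \<longleftrightarrow> x \<in> C0"
proof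
  assume "x \<in> C0"
  then show "scalar_product s x = 0"
    using s by (simp add: shadow_def dual_code_def)
next
  assume sx: "scalar_product s x = 0"
  show "x \<in> C0"
  proof (rule ccontr)
    assume "x \<notin> C0"
    have "scalar_product s y = 0" if y: "y \<in> C" for y
    proof (cases "y \<in> C0")
      case True
      then show ?thesis
        using s by (simp add: shadow_def dual_code_def)
    next
      case False
      then have "x + y \<in> C0"
        using \<open>x \<notin> C0\<close> x y by (simp add: add_in_C0_iff)
      then have "scalar_product s (x + y) = 0"
        using s by (simp add: shadow_def dual_code_def)
      then show ?thesis
        by (simp only: scalar_product_add_right sx add_0)
    qed
    then have "s \<in> C"
      by (rule self_dual_memI [OF self_dual])
    then show False
      using s by (simp add: shadow_def)
  qed
qed

lemma shadow_add:
  assumes s: "s \<in> shadow C" and x: "x \<in> C"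
  shows "weight (s + x) mod 4 = weight s mod 4"
proof -
  define q where "q = card {i. s $ i \<noteq> 0 \<and> x $ i \<noteq> 0}"
  have sum: "weight (s + x) + 2 * q = weight s + weight x"
    using weight_add [of s x] by (simp add: q_def)
  have par: "even q \<longleftrightarrow> weight x mod 4 = 0"
    using shadow_orthogonal_iff [OF s x] x by (simp only: scalar_product_eq_0_iff q_def C0_iff simp_thms)
  have "\<exists>i j. weight x + 4 * j = 2 * q + 4 * i"
  proof (cases "even q")
    case True
    then obtain j where "q = 2 * j"
      by (elim evenE)
    moreover have "weight x = 4 * (weight x div 4)"
      using par True by auto
    ultimately have "weight x + 4 * j = 2 * q + 4 * (weight x div 4)"
      by simp
    then show ?thesis
      by blast
  next
    case False
    then obtain j where "q = 2 * j + 1"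
      by (elim oddE)
    moreover have "weight x mod 4 = 2"
      using False par x weight_mod_4_outside_C0 [of x] by (simp add: C0_iff)
    then have "weight x = 4 * (weight x div 4) + 2"
      using div_mult_mod_eq [of "weight x" 4] by simp
    ultimately have "weight x + 4 * j = 2 * q + 4 * (weight x div 4)"
      by simp
    then show ?thesis
      by blast
  qed
  then obtain i j where "weight x + 4 * j = 2 * q + 4 * i"
    by blast
  with sum have "weight (s + x) + 4 * j = weight s + 4 * i"
    by simp
  then show ?thesis
    by (metis mod_mult_self2)
qed

text \<open>
  The MacWilliams identity at \<open>t = \<i>\<close> for the coset \<open>s + C\<close>.  On the side of the code
  the powers of \<open>-\<i>\<close> cancel the signs, so every codeword contributes \<open>(1 + \<i>) ^ (8 m) = 16 ^ m\<close>; on the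
  side of the coset all weights agree modulo \<open>4\<close>, so every vector contributes \<open>\<i> ^ weight s\<close>.
\<close>

lemma weight_shadow_mod_4:
  assumes s: "s \<in> shadow C"
  shows "weight s mod 4 = 0"
proof -
  have one_minus: "1 - \<i> = (- \<i>) * (1 + \<i>)"
    by (simp add: algebra_simps)
  have minus_i: "(- \<i>) ^ weight e = character s e" if "e \<in> C" for e
  proof -
    have "(- \<i>) ^ weight e = (- \<i>) ^ (weight e mod 4)"
      by (rule power_mod_4 [OF i_power_4(2)])
    then show ?thesis
      using shadow_orthogonal_iff [OF s that] that weight_mod_4_outside_C0 [of e]
      by (cases "e \<in> C0") (auto simp: C0_iff character_def bit_sign_def)
  qed
  have "(\<Sum>e\<in>C. character s e * (1 + \<i>) ^ (CARD('n) - weight e) * (1 - \<i>) ^ weight e) =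
        (\<Sum>e\<in>C. 16 ^ m)"
  proof (intro sum.cong refl)
    fix e assume e: "e \<in> C"
    have split: "(1 + \<i>) ^ (CARD('n) - weight e) * (1 + \<i>) ^ weight e = (1 + \<i>) ^ (8 * m)"
      using weight_le [of e] length by (simp flip: power_add)
    have square: "character s e * character s e = (1 :: complex)"
      by (simp add: character_def bit_sign_def)
    have "character s e * (1 + \<i>) ^ (CARD('n) - weight e) * (1 - \<i>) ^ weight e =
        (character s e * character s e) * ((1 + \<i>) ^ (CARD('n) - weight e) * (1 + \<i>) ^ weight e)"
      unfolding one_minus power_mult_distrib minus_i [OF e] by (simp only: mult_ac)
    also have "\<dots> = ((1 + \<i>) ^ 8) ^ m"
      unfolding split square by (simp only: mult_1 power_mult)
    also have "(1 + \<i>) ^ 8 = 16"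
      by (simp add: eval_nat_numeral algebra_simps)
    finally show "character s e * (1 + \<i>) ^ (CARD('n) - weight e) * (1 - \<i>) ^ weight e = 16 ^ m" .
  qed
  moreover have "(\<Sum>z | s + z \<in> C. \<i> ^ weight z) = (\<Sum>x\<in>C. \<i> ^ weight s)"
  proof -
    have "\<i> ^ weight z = \<i> ^ weight s" if "s + z \<in> C" for z
      using power_mod_4 [OF i_power_4(1), of "weight z"] power_mod_4 [OF i_power_4(1), of "weight s"]
        shadow_add [OF s that] by (simp only: vec_add_left_cancel)
    then show ?thesis
      by (intro sum.reindex_bij_witness [of _ "\<lambda>x. s + x" "\<lambda>z. s + z"])
         (auto intro: sym)
  qed
  moreover have "dual_code C = C" "card C = 16 ^ m" "CARD('n) = 8 * m"
    using self_dual card_self_dual [OF self_dual length] length by (simp_all add: self_dual_def)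
  ultimately have "\<i> ^ weight s = 1"
    using macwilliams [OF self_dual_linear [OF self_dual], of s \<i>] by simp
  then show ?thesis
    by (rule mod_4_eq_0_if_i_power_eq_1)
qed

text \<open>
  The union of \<open>C0\<close> and its translate by \<open>s\<close>; as \<open>s + s = 0\<close>, the condition \<open>s + x \<in> C0\<close> says that
  \<open>x\<close> lies in \<open>s + C0\<close>.
\<close>

definition neighbour :: "bit ^ 'n \<Rightarrow> (bit ^ 'n) set" where
  "neighbour s = {x. x \<in> C0 \<or> s + x \<in> C0}"

lemma s_add_notin_C: "s \<in> shadow C \<Longrightarrow> s + x \<in> C \<Longrightarrow> x \<notin> C"
  using add_mem [of "s + x" x] by (auto simp: shadow_def add.assoc)

lemma neighbour_shadow:
  assumes s: "s \<in> shadow C" and x: "s + x \<in> C"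
  shows "x \<in> shadow C"
proof -
  have "s + (s + x) \<in> dual_code C0"
    using s x C_subset_dual_C0 linear_dual_code [of C0] unfolding shadow_def linear_code_def by blast
  then show ?thesis
    using s_add_notin_C [OF s x] by (simp add: shadow_def)
qed

text \<open>
  Self-orthogonality holds because \<open>s\<close> is orthogonal to \<open>C0\<close> and to itself.  Conversely, a vector
  orthogonal to \<open>C0\<close> lies in \<open>C\<close> or in the shadow \<open>s + C\<close>, and orthogonality to \<open>s\<close> selects the
  part in \<open>C0\<close> or \<open>s + C0\<close>.
\<close>

lemma doubly_even_neighbour:
  assumes s: "s \<in> shadow C"
  shows "doubly_even_code (neighbour s) m"
proof
  show "CARD('n) = 8 * m"
    by (rule length)
  show "weight x mod 4 = 0" if "x \<in> neighbour s" for x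
    using that weight_shadow_mod_4 [of x] neighbour_shadow [OF s, of x]
    by (auto simp: neighbour_def C0_iff)
  have ss: "scalar_product s s = 0"
    using weight_shadow_mod_4 [OF s] by (simp only: scalar_product_self_eq_0_iff) presburger
  have sC0: "scalar_product s x = 0" if "x \<in> C0" for x
    using that s by (simp add: shadow_def dual_code_def)
  have orth: "scalar_product x y = 0" if "x \<in> C0" "y \<in> C0" for x y
    using that self_dual_orthogonal [OF self_dual] by (simp add: C0_iff)
  have decompose: "x \<in> neighbour s \<longleftrightarrow> (\<exists>c\<in>C0. x = c \<or> x = s + c)" for x
    by (auto simp: neighbour_def intro: bexI [of _ "s + x"])
  have "neighbour s \<subseteq> dual_code (neighbour s)"
  proof -
    have "scalar_product x y = 0" if "x \<in> neighbour s" "y \<in> neighbour s" for x y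
    proof -
      obtain c d where c: "c \<in> C0" "x = c \<or> x = s + c" and d: "d \<in> C0" "y = d \<or> y = s + d"
        using \<open>x \<in> neighbour s\<close> \<open>y \<in> neighbour s\<close> by (auto simp: decompose)
      have "scalar_product c s = 0" "scalar_product s d = 0" "scalar_product c d = 0"
        using c(1) d(1) sC0 orth by (simp_all only: scalar_product_commute [of c s])
      then show ?thesis
        using c(2) d(2) ss by (elim disjE) (simp_all only: scalar_product_add_left scalar_product_add_right add_0)
    qed
    then show ?thesis
      by (auto simp: dual_code_def)
  qed
  moreover have "dual_code (neighbour s) \<subseteq> neighbour s"
  proof
    fix x assume x: "x \<in> dual_code (neighbour s)"
    have xC0: "x \<in> dual_code C0"
      using x by (auto simp: dual_code_def neighbour_def)
    have "s \<in> neighbour s"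
      using linear_C0 by (simp add: neighbour_def linear_code_def)
    then have sx: "scalar_product s x = 0"
      using x by (subst scalar_product_commute) (simp add: dual_code_def)
    show "x \<in> neighbour s"
    proof (cases "x \<in> C")
      case True
      then show ?thesis
        using shadow_orthogonal_iff [OF s True] sx by (simp add: neighbour_def)
    next
      case False
      then have xS: "x \<in> shadow C"
        using xC0 by (simp add: shadow_def)
      have "scalar_product (s + x) y = 0" if y: "y \<in> C" for y
      proof -
        have "scalar_product s y = scalar_product x y"
          using shadow_orthogonal_iff [OF s y] shadow_orthogonal_iff [OF xS y]
          by (metis bit_not_zero_iff)
        then show ?thesis
          by (simp only: scalar_product_add_left bit_add_self)
      qed
      then have "s + x \<in> C"
        by (rule self_dual_memI [OF self_dual])
      moreover have "scalar_product s (s + x) = 0"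
        by (simp only: scalar_product_add_right ss sx add_0)
      ultimately show ?thesis
        using shadow_orthogonal_iff [OF s] by (simp add: neighbour_def)
    qed
  qed
  ultimately show "self_dual (neighbour s)"
    by (simp add: self_dual_def)
qed

end

section \<open>Non-existence of the extremal codes\<close>

theorem theorem10:
  fixes k :: nat
  assumes "k \<ge> 148"
  shows "(\<nexists>C :: (bit ^ 'n) set.
            is_code_dist (24 * k + 16) (12 * k + 8) (4 * k + 4) C \<and>
            singly_even_self_dual C \<and> s_extremal C) \<and>
         (\<nexists>C :: (bit ^ 'n) set.
            is_code_dist (24 * k + 16) (12 * k + 8) (4 * k + 4) C \<and>
            doubly_even_self_dual C \<and> extremal C \<and>
            covering_radius C = 4 * k + 4) \<and>
         (\<nexists>C :: (bit ^ 'n) set.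
            is_code_dist (24 * k + 16) (12 * k + 8) (4 * k + 4) C \<and>
            doubly_even_self_dual C \<and> extremal C \<and>
            covering_radius C = 4 * k + 4 \<and> meets_delsarte_bound C)"
proof -
  define m where "m = 3 * k + 2"
  have no_singly_even: False
    if dist: "is_code_dist (24 * k + 16) (12 * k + 8) (4 * k + 4) C"
      and C: "singly_even_self_dual C" and extr: "s_extremal C" for C :: "(bit ^ 'n) set"
  proof -
    have card: "CARD('n) = 8 * m" and dC: "min_weight C = 4 * k + 4"
      using dist by (auto simp: is_code_dist_def is_code_def m_def)
    interpret singly_even_code C m
      using C card by unfold_locales (auto simp: singly_even_self_dual_def)
    have "real (min_weight (shadow C)) = real (4 * k + 4)"
      using extr by (simp add: s_extremal_def card dC m_def)
    then have dS: "min_weight (shadow C) = 4 * k + 4"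
      by (simp only: of_nat_eq_iff)
    have far: "4 * k + 4 \<le> weight x" if "x \<in> C \<union> shadow C" "x \<noteq> 0" for x
      using that min_weight_le [of x C] min_weight_le [of x "shadow C"] by (auto simp: dC dS)
    obtain s where s: "s \<in> shadow C"
      using shadow_nonempty by auto
    obtain c where c: "c \<in> C" "c \<notin> C0"
      using singly_even by (auto simp: doubly_even_subcode_def)
    interpret D: doubly_even_code "neighbour s" m
      by (rule doubly_even_neighbour [OF s])
    have mem: "x \<in> C \<union> shadow C" if "x \<in> C \<or> s + x \<in> C" for x
      using that neighbour_shadow [OF s] by auto
    (* The coset of the neighbour through c consists of C - C0 and of s + (C - C0), a part of
       the shadow, and therefore avoids 0. *)
    show False
    proof (rule D.no_distant_coset [of k c])
      show "148 \<le> k" "m = 3 * k + 2"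
        using assms by (simp_all add: m_def)
      show "4 * k + 4 \<le> weight x" if "x \<in> neighbour s" "x \<noteq> 0" for x
        using that by (intro far mem) (auto simp: neighbour_def C0_iff)
      show "4 * k + 4 \<le> weight z" if z: "c + z \<in> neighbour s" for z
      proof (rule far, rule mem)
        have "c + z \<in> C \<or> c + (s + z) \<in> C"
          using z by (auto simp: neighbour_def C0_iff add.left_commute)
        then show "z \<in> C \<or> s + z \<in> C"
          using add_mem [OF c(1)] by (metis vec_add_left_cancel)
        show "z \<noteq> 0"
        proof
          assume "z = 0"
          then have "s + c \<in> C"
            using z c by (simp add: neighbour_def C0_iff)
          then show False
            using s_add_notin_C [OF s] c(1) by blast
        qed
      qed
    qed
  qed
  have no_doubly_even: False
    if dist: "is_code_dist (24 * k + 16) (12 * k + 8) (4 * k + 4) C"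
      and C: "doubly_even_self_dual C" and radius: "covering_radius C = 4 * k + 4"
    for C :: "(bit ^ 'n) set"
  proof -
    have card: "CARD('n) = 8 * m" and dC: "min_weight C = 4 * k + 4"
      using dist by (auto simp: is_code_dist_def is_code_def m_def)
    interpret doubly_even_code C m
      using C card by unfold_locales (auto simp: doubly_even_self_dual_def)
    obtain v where v: "\<And>c. c \<in> C \<Longrightarrow> 4 * k + 3 < weight (c + v)"
      using far_vector_if_covering_radius [of C "4 * k + 3"] radius by auto
    show False
    proof (rule no_distant_coset [of k v])
      show "148 \<le> k" "m = 3 * k + 2"
        using assms by (simp_all add: m_def)
      show "4 * k + 4 \<le> weight x" if "x \<in> C" "x \<noteq> 0" for x
        using min_weight_le [OF that] by (simp add: dC)
      show "4 * k + 4 \<le> weight z" if "v + z \<in> C" for z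
        using v [OF that] by (simp add: add_ac)
    qed
  qed
  show ?thesis
    using no_singly_even no_doubly_even by blast
qed

end
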